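(* Let $N,T\ge1$ be integers, let $\{s_i\}_{i=0}^{T-1}$ be a sample size sequence of positive integers with $s_i\le N$, let $\epsilon>0$, $\delta\in(0,1)$ and $\sigma>0$. Put $$K=\sum_{i=0}^{T-1}s_i,\qquad \bar s=\frac1T\sum_{i=0}^{T-1}s_i=\frac KT,\qquad s_{max}=\max\{s_0,\dots,s_{T-1}\},\qquad \theta=\frac{s_{max}}{\bar s},$$ $$h(x)=\left(\sqrt{1+(e/x)^2}-e/x\right)^2,\qquad g(x)=\min\left\{\frac1{ex},\,h(x)\right\}.$$ Let $\gamma$ be the smallest positive real number such that, with $\bar\alpha=\frac{\epsilon N}{\gamma K}$, one has $\bar\alpha<1$, $\sigma(1-\bar\alpha)-2e\sqrt{\bar\alpha}>0$ and $$\gamma\;\ge\;\frac{2}{1-\bar\alpha}+\frac{2^4\,\bar\alpha}{1-\bar\alpha}\left(\frac{\sigma}{(1-\sqrt{\bar\alpha})^2}+\frac{1}{\sigma(1-\bar\alpha)-2e\sqrt{\bar\alpha}}\cdot\frac{e^3}{\sigma}\right)e^{3/\sigma^2}.$$ If the following four requirements are satisfied: $$\bar s\le\frac{g\!\left(\sqrt{2(\epsilon+\ln(1/\delta))/\epsilon}\right)}{\theta}\cdot N,\qquad \epsilon\le\gamma\, h(\sigma)\cdot\frac KN,$$ $$\epsilon\ge\gamma\,\theta^2\cdot\frac KN\cdot\frac{\bar s}{N},\qquad \sigma\ge\sqrt{2(\epsilon+\ln(1/\delta))/\epsilon},$$ then the (asynchronous) DP-SGD algorithm run for $T$ rounds with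 sample sizes $\{s_i\}$, data set size $N$ and noise parameters $\sigma_i=\sigma$ for all $i$ is $(\epsilon,\delta)$-differentially private.
   Context: **Adjacency and differential privacy.** Two data sets $d,d'$ are adjacent if one is obtained from the other by adding exactly one element; here the larger of the two has $N$ elements. A randomized mechanism $\mathcal M$ is $(\epsilon,\delta)$-differentially private if for all adjacent $d,d'$ (in either order) and all (measurable) sets $S$ of outputs, $\Pr[\mathcal M(d)\in S]\le e^{\epsilon}\Pr[\mathcal M(d')\in S]+\delta$. **Clipping.** For a constant $C>0$ and a vector $x$, $[x]_C=x/\max\{1,\|x\|/C\}$ (Euclidean norm), so $\|[x]_C\|\le C$. **Asynchronous DP-SGD algorithm (client side).** Input: a client's data set $d$. Parameters: $N$, number of rounds $T$, sample sizes $s_0,\dots,s_{T-1}$, clipping constant $C>0$, noise parameters $\sigma_i>0$, step sizes, and a loss $f(w,\xi)$ with gradient $\nabla f(w,\xi)$ in $w\in\mathbb R^m$. The client keeps a local model $\hat w$. In round $i=0,\dots,T-1$: 1. The client draws a random sample $J_i\subseteq d$ by including each element of $d$ independently with probability $s_i/N$ (so $s_i$ is the sample size in expectation), independently of everything else. 2. It outputs $U_i=\sum_{\xi\in J_i}[\nabla f(\hat w_{i,\xi},\xi)]_C+n_i$, with fresh noise $n_i\sim\mathcal N(0,C^2\sigma_i^2\mathbf I)$, where $\hat w_{i,\xi}$ is the local model in use when $\xi$ is processed. The local model is not changed by gradients computed within the round, but may be replaced during the round by a newly received global model. 3. After the round the local model is updated as $\hat w\leftarrow \hat w+\bar\eta_i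 U_i$ with a fixed step size $\bar\eta_i$. Let $\texttt{aux}$ in round $i$ consist of the previous outputs $U_0,\dots,U_{i-1}$ together with the global models received in round $i$. Global models sent by the server may depend arbitrarily (possibly randomly) on previous outputs and on data independent of $d$, but not on the gradients or the sample of the current round; given $\texttt{aux}$, the models $\hat w_{i,\xi}$ are determined and do not depend on the sample $J_i$. (The synchronous algorithm, where a single model $\hat w$ is used in each round, is a special case.) The output of the algorithm is $(U_0,\dots,U_{T-1})$. "The algorithm is $(\epsilon,\delta)$-differentially private" means this holds for every loss $f$, every $C>0$, and every server behaviour as described. *)

theory Defs
  imports "HOL-Probability.Probability"
begin

section \<open>Adjacency and differential privacy\<close>

definition adjacent :: "nat \<Rightarrow> 'x set \<Rightarrow> 'x set \<Rightarrow> bool" where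
  "adjacent N d d' \<longleftrightarrow> finite d \<and> finite d' \<and>
     ((\<exists>x. x \<notin> d \<and> d' = insert x d \<and> card d' = N) \<or>
      (\<exists>x. x \<notin> d' \<and> d = insert x d' \<and> card d = N))"

text \<open>A mechanism maps a data set to the distribution of its output on the measurable space \<open>L\<close>.\<close>

definition differentially_private ::
    "nat \<Rightarrow> real \<Rightarrow> real \<Rightarrow> 'o measure \<Rightarrow> ('x set \<Rightarrow> 'o measure) \<Rightarrow> bool" where
  "differentially_private N \<epsilon> \<delta> L M \<longleftrightarrow>
     (\<forall>d d'. adjacent N d d' \<longrightarrow>
       (\<forall>S\<in>sets L. measure (M d) S \<le> exp \<epsilon> * measure (M d') S + \<delta>))"


section \<open>Gradients, clipping, noise and sampling\<close>

definition loss_gradient ::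
    "(real ^ 'm \<Rightarrow> 'x \<Rightarrow> real) \<Rightarrow> real ^ 'm::finite \<Rightarrow> 'x \<Rightarrow> real ^ 'm" where
  "loss_gradient f w \<xi> = (THE D. GDERIV (\<lambda>v. f v \<xi>) w :> D)"

definition clip :: "real \<Rightarrow> 'v::real_normed_vector \<Rightarrow> 'v" where
  "clip C x = x /\<^sub>R max 1 (norm x / C)"

text \<open>The centred Gaussian with covariance \<open>\<tau>\<^sup>2 I\<close>; the scale parameter of
  \<^const>\<open>normal_density\<close> is the standard deviation.\<close>

definition gaussian_noise :: "real \<Rightarrow> (real ^ 'm::finite) measure" where
  "gaussian_noise \<tau> = density lborel (\<lambda>x. ennreal (\<Prod>j\<in>UNIV. normal_density 0 \<tau> (x $ j)))"

definition poisson_sample :: "real \<Rightarrow> 'x set \<Rightarrow> 'x set pmf" where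
  "poisson_sample q d =
     map_pmf (\<lambda>b. {\<xi>\<in>d. b \<xi>}) (Pi_pmf d False (\<lambda>_. bernoulli_pmf q))"


section \<open>Server behaviour\<close>

text \<open>
  All randomness of the server (and of the network timing), as well as all data it uses that is
  independent of the client's data set, is collected in one seed \<open>\<omega>\<close>, drawn from \<open>seed\<close>
  independently of the client's sampling and noise.  What happens in round \<open>i\<close> is a function of
  \<open>\<omega>\<close> and of the previous outputs \<open>u = (U\<^sub>0, \<dots>, U\<^sub>i\<^sub>-\<^sub>1)\<close>, an element of the product space
  over the index set \<open>{..<i}\<close>.  In round \<open>i\<close> the client receives the \<open>num_received\<close> many global
  models \<open>received i \<omega> u 0\<close>, \<open>received i \<omega> u 1\<close>, \<open>\<dots>\<close> in this order, and
  \<open>arrived i \<omega> u \<xi>\<close> is the number of them that have arrived by the time \<open>\<xi>\<close> is processed.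
\<close>

record ('s, 'x, 'm) server =
  seed :: "'s measure"
  initial_model :: "real ^ 'm"
  num_received :: "nat \<Rightarrow> 's \<Rightarrow> (nat \<Rightarrow> real ^ 'm) \<Rightarrow> nat"
  received :: "nat \<Rightarrow> 's \<Rightarrow> (nat \<Rightarrow> real ^ 'm) \<Rightarrow> nat \<Rightarrow> real ^ 'm"
  arrived :: "nat \<Rightarrow> 's \<Rightarrow> (nat \<Rightarrow> real ^ 'm) \<Rightarrow> 'x \<Rightarrow> nat"

abbreviation output_space :: "nat \<Rightarrow> (nat \<Rightarrow> real ^ 'm::finite) measure" where
  "output_space i \<equiv> PiM {..<i} (\<lambda>_. borel)"

definition valid_server :: "nat \<Rightarrow> ('s, 'x, 'm::finite) server \<Rightarrow> bool" where
  "valid_server T srv \<longleftrightarrow> prob_space (seed srv) \<and>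
     (\<forall>i<T.
       (\<lambda>(\<omega>, u). num_received srv i \<omega> u)
         \<in> seed srv \<Otimes>\<^sub>M output_space i \<rightarrow>\<^sub>M count_space UNIV \<and>
       (\<forall>k. (\<lambda>(\<omega>, u). received srv i \<omega> u k)
         \<in> seed srv \<Otimes>\<^sub>M output_space i \<rightarrow>\<^sub>M borel) \<and>
       (\<forall>\<xi>. (\<lambda>(\<omega>, u). arrived srv i \<omega> u \<xi>)
         \<in> seed srv \<Otimes>\<^sub>M output_space i \<rightarrow>\<^sub>M count_space UNIV) \<and>
       (\<forall>\<omega>\<in>space (seed srv). \<forall>u\<in>space (output_space i). \<forall>\<xi>.
         arrived srv i \<omega> u \<xi> \<le> num_received srv i \<omega> u))"


section \<open>Asynchronous DP-SGD\<close>

text \<open>The model in use after \<open>k\<close> global models have arrived in round \<open>i\<close>, if the round started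
  with local model \<open>w\<close>.\<close>

definition current_model ::
    "('s, 'x, 'm::finite) server \<Rightarrow> nat \<Rightarrow> 's \<Rightarrow> (nat \<Rightarrow> real ^ 'm) \<Rightarrow> real ^ 'm \<Rightarrow> nat \<Rightarrow> real ^ 'm" where
  "current_model srv i \<omega> u w k = (if k = 0 then w else received srv i \<omega> u (k - 1))"

text \<open>The local model at the beginning of a round.\<close>

primrec start_model ::
    "('s, 'x, 'm::finite) server \<Rightarrow> (nat \<Rightarrow> real) \<Rightarrow> nat \<Rightarrow> 's \<Rightarrow> (nat \<Rightarrow> real ^ 'm) \<Rightarrow> real ^ 'm" where
  "start_model srv \<eta> 0 \<omega> u = initial_model srv"
| "start_model srv \<eta> (Suc i) \<omega> u =
     (let u' = restrict u {..<i}
      in current_model srv i \<omega> u' (start_model srv \<eta> i \<omega> u') (num_received srv i \<omega> u')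
           + \<eta> i *\<^sub>R u i)"

definition model_at ::
    "('s, 'x, 'm::finite) server \<Rightarrow> (nat \<Rightarrow> real) \<Rightarrow> nat \<Rightarrow> 's \<Rightarrow> (nat \<Rightarrow> real ^ 'm) \<Rightarrow> 'x \<Rightarrow> real ^ 'm" where
  "model_at srv \<eta> i \<omega> u \<xi> =
     current_model srv i \<omega> u (start_model srv \<eta> i \<omega> u) (arrived srv i \<omega> u \<xi>)"

locale dpsgd_parameters =
  fixes N :: nat
    and s :: "nat \<Rightarrow> nat"
    and noise :: "nat \<Rightarrow> real"
    and C :: real
    and \<eta> :: "nat \<Rightarrow> real"
    and f :: "real ^ 'm::finite \<Rightarrow> 'x \<Rightarrow> real"
    and srv :: "('s, 'x, 'm) server"
begin

text \<open>The conditional distribution of \<open>U\<^sub>i\<close> given the seed and the previous outputs.\<close>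

definition round_output :: "'x set \<Rightarrow> nat \<Rightarrow> 's \<Rightarrow> (nat \<Rightarrow> real ^ 'm) \<Rightarrow> (real ^ 'm) measure" where
  "round_output d i \<omega> u =
     measure_pmf (poisson_sample (real (s i) / real N) d) \<bind>
       (\<lambda>J. distr (gaussian_noise (C * noise i)) borel
         (\<lambda>n. (\<Sum>\<xi>\<in>J. clip C (loss_gradient f (model_at srv \<eta> i \<omega> u \<xi>) \<xi>)) + n))"

primrec outputs_given :: "'x set \<Rightarrow> nat \<Rightarrow> 's \<Rightarrow> (nat \<Rightarrow> real ^ 'm) measure" where
  "outputs_given d 0 \<omega> = return (output_space 0) (\<lambda>_. undefined)"
| "outputs_given d (Suc i) \<omega> =
     outputs_given d i \<omega> \<bind>
       (\<lambda>u. distr (round_output d i \<omega> u) (output_space (Suc i)) (\<lambda>v. u(i := v)))"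

definition dpsgd :: "nat \<Rightarrow> 'x set \<Rightarrow> (nat \<Rightarrow> real ^ 'm) measure" where
  "dpsgd T d = seed srv \<bind> outputs_given d T"

end


section \<open>Parameter functions\<close>

definition h_fun :: "real \<Rightarrow> real" where
  "h_fun x = (sqrt (1 + (exp 1 / x)\<^sup>2) - exp 1 / x)\<^sup>2"

definition g_fun :: "real \<Rightarrow> real" where
  "g_fun x = min (1 / (exp 1 * x)) (h_fun x)"

definition gamma_admissible :: "nat \<Rightarrow> real \<Rightarrow> real \<Rightarrow> real \<Rightarrow> real \<Rightarrow> bool" where
  "gamma_admissible N K \<epsilon> \<sigma> \<gamma> \<longleftrightarrow> \<gamma> > 0 \<and>
     (let \<alpha> = \<epsilon> * real N / (\<gamma> * K)
      in \<alpha> < 1 \<and> \<sigma> * (1 - \<alpha>) - 2 * exp 1 * sqrt \<alpha> > 0 \<and>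
         \<gamma> \<ge> 2 / (1 - \<alpha>) +
           2 ^ 4 * \<alpha> / (1 - \<alpha>) *
             (\<sigma> / (1 - sqrt \<alpha>)\<^sup>2 +
              1 / (\<sigma> * (1 - \<alpha>) - 2 * exp 1 * sqrt \<alpha>) * (exp 1 ^ 3 / \<sigma>)) *
             exp (3 / \<sigma>\<^sup>2))"

end

theory Submission
  imports Defs
begin

text \<open>
  The proof bounds Renyi moments of the single order \<open>a = \<lceil>v\<rceil>\<close>, where \<open>v = 2(\<epsilon> + ln(1/\<delta>))/\<epsilon> \<le> \<sigma>\<^sup>2\<close>.
  For fixed previous outputs, seed and sample of the common records, a round compares a Gaussian
  \<open>\<phi>\<close> with its mixture \<open>(1 - q) \<phi> + q \<phi>(\<cdot> - g)\<close>, \<open>\<parallel>g\<parallel> \<le> C\<close>, and the moment is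
  \<open>E exp (k (k - 1) \<parallel>g\<parallel>\<^sup>2 / (2 \<tau>\<^sup>2))\<close> for a binomial \<open>k\<close> with parameters \<open>a, q\<close>.  The factor \<open>k (k - 1)\<close>
  in the exponent produces \<open>q\<^sup>2\<close>, and \<open>q \<le> 1 / (e \<surd>v)\<close> keeps what remains bounded: the moment is at
  most \<open>1 + q\<^sup>2 (2 a - v)\<close>.  The reversed comparison is no larger, by the reflection \<open>x \<mapsto> g - x\<close>, which
  exchanges the two Gaussians.  Moments multiply over the rounds; the third requirement and
  \<open>\<gamma> \<ge> 2\<close> give \<open>\<Sum> q\<^sub>i\<^sup>2 \<le> \<epsilon> / 2\<close>, which is exactly what a Markov-type tail bound at order \<open>a\<close> needs.
\<close>

subsection \<open>Moments of the binomial distribution\<close>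

text \<open>The binomial expansion of the moment needs an integer order, so \<open>v\<close> is
  rounded up, and the estimates are arranged so that the rounding costs nothing. If the squared
  rates sum to at most \<epsilon> / 2, the tail bound of order a tolerates a logarithmic moment of
  (\<epsilon> / 2) (2 a - v). A round may therefore cost q^2 (2 a - v), which is the tangent at a =
  v to q^2 a^2 / v. The cost obtained is q^2 a (a - 1) / v, and the gap a / v between the two
  quadratics pays for the rounding error.

  The obstacle is that the exponents k (k - 1) / (2 v) are not small: for k near a they are about v
  / 2. So only one factor k (k - 1) is split off, and the exponential moment that remains has to be
  bounded by a constant, uniformly in v. That constant is 3 because (1 + 3) / (4 v) = 1 / v; the
  numerical estimates below exist to reach it.\<close>

lemma bernoulli_mgf_le:
  fixes q t :: real
  assumes "0 \<le> q" "q \<le> 1"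
  shows "1 - q + q * exp t \<le> exp (q * t + t\<^sup>2 / 8)"
proof -
  have nonneg: "1 - p + p * exp h \<le> exp (p * h + h\<^sup>2 / 8)"
    if p: "0 \<le> p" "p \<le> 1" and h: "h \<ge> 0" for p h :: real
  proof -
    have pos: "1 + p * (exp h - 1) > 0"
      using p h by (intro add_pos_nonneg mult_nonneg_nonneg) auto
    have "ln (1 + p * (exp h - 1)) \<le> p * h + h\<^sup>2 / 8"
      using Hoeffdings_lemma_aux[OF h p(1)] by (simp add: mult.commute)
    then have "1 + p * (exp h - 1) \<le> exp (p * h + h\<^sup>2 / 8)"
      using pos by (metis exp_le_cancel_iff exp_ln)
    then show ?thesis by (simp add: algebra_simps)
  qed
  show ?thesis
  proof (cases "t \<ge> 0")
    case True
    then show ?thesis using nonneg assms by blast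
  next
    case False
    \<comment> \<open>For negative \<open>t\<close>, success and failure exchange roles: 1 - q + q
      e^t = e^t (q + (1 - q) e^(-t)).\<close>
    have "1 - (1 - q) + (1 - q) * exp (- t) \<le> exp ((1 - q) * (- t) + (- t)\<^sup>2 / 8)"
      by (rule nonneg) (use assms False in auto)
    then have "exp t * (q + (1 - q) * exp (- t)) \<le> exp t * exp ((1 - q) * (- t) + (- t)\<^sup>2 / 8)"
      by (intro mult_left_mono) auto
    also have "\<dots> = exp (q * t + t\<^sup>2 / 8)"
      unfolding exp_add[symmetric] by (simp add: algebra_simps)
    also have "exp t * (q + (1 - q) * exp (- t)) = 1 - q + q * exp t"
      by (simp add: exp_minus field_simps)
    finally show ?thesis .
  qed
qed

lemma has_bochner_integral_normal_exp:
  fixes \<tau> b :: real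
  assumes "\<tau> > 0"
  shows "has_bochner_integral lborel (\<lambda>x. normal_density 0 \<tau> x * exp (b * x)) (exp (b\<^sup>2 * \<tau>\<^sup>2 / 2))"
proof -
  have "normal_density 0 \<tau> x * exp (b * x) = normal_density (b * \<tau>\<^sup>2) \<tau> x * exp (b\<^sup>2 * \<tau>\<^sup>2 / 2)" for x
  proof -
    have "- (x - 0)\<^sup>2 / (2 * \<tau>\<^sup>2) + b * x = - (x - b * \<tau>\<^sup>2)\<^sup>2 / (2 * \<tau>\<^sup>2) + b\<^sup>2 * \<tau>\<^sup>2 / 2"
      using assms by (simp add: field_simps power2_eq_square)
    then show ?thesis
      unfolding normal_density_def by (simp add: exp_add[symmetric])
  qed
  moreover have "has_bochner_integral lborel (\<lambda>x. normal_density (b * \<tau>\<^sup>2) \<tau> x * exp (b\<^sup>2 * \<tau>\<^sup>2 / 2))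
      (1 * exp (b\<^sup>2 * \<tau>\<^sup>2 / 2))"
    using assms by (intro has_bochner_integral_mult_left) (auto simp: has_bochner_integral_iff)
  ultimately show ?thesis by simp
qed

text \<open>A quadratic tilt only changes the variance: the standard normal density times exp
  (\<kappa> z^2) is an unnormalised normal density of precision r = 1 - 2 \<kappa>. This explains
  both the hypothesis on \<kappa> and the factor 1 / sqrt r.\<close>

lemma has_bochner_integral_std_normal_exp_quadratic:
  fixes b \<kappa> :: real
  assumes "\<kappa> < 1 / 2"
  shows "has_bochner_integral lborel (\<lambda>z. std_normal_density z * exp (b * z + \<kappa> * z\<^sup>2))
           (exp (b\<^sup>2 / (2 * (1 - 2 * \<kappa>))) / sqrt (1 - 2 * \<kappa>))"
proof -
  define r where "r = 1 - 2 * \<kappa>"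
  have r: "r > 0" using assms by (simp add: r_def)
  have "std_normal_density z * exp (b * z + \<kappa> * z\<^sup>2)
      = normal_density 0 (1 / sqrt r) z * exp (b * z) * (1 / sqrt r)" for z
  proof -
    have "exp (- z\<^sup>2 / 2) * exp (\<kappa> * z\<^sup>2) = exp (- (z\<^sup>2 * r) / 2)"
      unfolding exp_add[symmetric] r_def by (simp add: field_simps)
    moreover have "normal_density 0 (1 / sqrt r) z = sqrt r / sqrt (2 * pi) * exp (- (z\<^sup>2 * r) / 2)"
      using r by (simp add: normal_density_def real_sqrt_divide power_divide)
    ultimately show ?thesis
      using r by (simp add: std_normal_density_def exp_add)
  qed
  moreover have "has_bochner_integral lborel
      (\<lambda>z. normal_density 0 (1 / sqrt r) z * exp (b * z) * (1 / sqrt r))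
      (exp (b\<^sup>2 * (1 / sqrt r)\<^sup>2 / 2) * (1 / sqrt r))"
    using r by (intro has_bochner_integral_mult_left has_bochner_integral_normal_exp) auto
  ultimately show ?thesis
    using r by (simp add: r_def power_divide)
qed

text \<open>Writing the Gaussian factor as the moment generating function of a standard normal \<open>z\<close> makes
  the exponent linear in \<open>j\<close>, so that the binomial theorem and Hoeffding's lemma apply.\<close>

lemma binomial_exp_quadratic_le:
  fixes q v c :: real and n :: nat
  assumes q: "0 \<le> q" "q \<le> 1" and v: "v > 0" and n: "real n < 4 * v"
  shows "(\<Sum>j\<le>n. real (n choose j) * q ^ j * (1 - q) ^ (n - j) * exp ((c + real j)\<^sup>2 / (2 * v)))
      \<le> exp ((c + real n * q)\<^sup>2 / (2 * (v - real n / 4))) / sqrt (1 - real n / (4 * v))"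
proof -
  define w where "w = 1 / sqrt v"
  have w2: "w\<^sup>2 = 1 / v" using v by (simp add: w_def power_divide)
  have lhs: "has_bochner_integral lborel
      (\<lambda>z. \<Sum>j\<le>n. (std_normal_density z * exp (((c + real j) * w) * z))
          * (real (n choose j) * q ^ j * (1 - q) ^ (n - j)))
      (\<Sum>j\<le>n. exp (((c + real j) * w)\<^sup>2 * 1\<^sup>2 / 2) * (real (n choose j) * q ^ j * (1 - q) ^ (n - j)))"
    by (intro has_bochner_integral_sum has_bochner_integral_mult_left
        has_bochner_integral_normal_exp) auto
  \<comment> \<open>Hoeffding's lemma contributes (w z)^2 / 8 for each of the \<open>n\<close>
    trials, that is, a Gaussian tilt by \<kappa> z^2. The hypothesis n < 4 v is the integrability
    condition for this tilt.\<close>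
  define \<kappa> where "\<kappa> = real n * w\<^sup>2 / 8"
  have "\<kappa> < 1 / 2"
    using n v by (simp add: \<kappa>_def w2 field_simps)
  note rhs = has_bochner_integral_std_normal_exp_quadratic[OF this, of "(c + real n * q) * w"]
  have le: "(\<Sum>j\<le>n. (std_normal_density z * exp (((c + real j) * w) * z))
          * (real (n choose j) * q ^ j * (1 - q) ^ (n - j)))
      \<le> std_normal_density z * exp ((c + real n * q) * w * z + \<kappa> * z\<^sup>2)" for z
  proof -
    have "(\<Sum>j\<le>n. (std_normal_density z * exp (((c + real j) * w) * z))
          * (real (n choose j) * q ^ j * (1 - q) ^ (n - j)))
      = (\<Sum>j\<le>n. std_normal_density z * exp (c * w * z) *
           (real (n choose j) * (q * exp (w * z)) ^ j * (1 - q) ^ (n - j)))"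
      by (intro sum.cong refl)
        (simp add: algebra_simps exp_add power_mult_distrib exp_of_nat_mult[symmetric])
    also have "\<dots> = std_normal_density z * exp (c * w * z) * (q * exp (w * z) + (1 - q)) ^ n"
      by (simp add: binomial_ring sum_distrib_left)
    also have "\<dots> \<le> std_normal_density z * exp (c * w * z) * exp (q * (w * z) + (w * z)\<^sup>2 / 8) ^ n"
      using bernoulli_mgf_le[OF q, of "w * z"] q
      by (intro mult_left_mono power_mono mult_nonneg_nonneg add_nonneg_nonneg) (auto simp: add.commute)
    also have "\<dots> = std_normal_density z * exp ((c + real n * q) * w * z + \<kappa> * z\<^sup>2)"
      by (simp add: exp_of_nat_mult[symmetric] exp_add[symmetric] \<kappa>_def algebra_simps
          power_mult_distrib)
    finally show ?thesis .
  qed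
  have "(\<Sum>j\<le>n. exp (((c + real j) * w)\<^sup>2 * 1\<^sup>2 / 2) * (real (n choose j) * q ^ j * (1 - q) ^ (n - j)))
      \<le> exp (((c + real n * q) * w)\<^sup>2 / (2 * (1 - 2 * \<kappa>))) / sqrt (1 - 2 * \<kappa>)"
    using integral_mono[OF integrable.intros[OF lhs]
        integrable.intros[OF rhs] le]
    unfolding has_bochner_integral_integral_eq[OF lhs] has_bochner_integral_integral_eq[OF rhs] .
  also have "1 - 2 * \<kappa> = 1 - real n / (4 * v)"
    by (simp add: \<kappa>_def w2)
  also have "((c + real n * q) * w)\<^sup>2 / (2 * (1 - real n / (4 * v)))
      = (c + real n * q)\<^sup>2 / (2 * (v - real n / 4))"
  proof -
    have "(c + real n * q)\<^sup>2 * (1 / v) / (2 * (1 - real n / (4 * v)))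
        = (c + real n * q)\<^sup>2 / (v * (2 * (1 - real n / (4 * v))))" by simp
    also have "v * (2 * (1 - real n / (4 * v))) = 2 * (v - real n / 4)"
      using v by (simp add: field_simps)
    finally show ?thesis by (simp add: power_mult_distrib w2)
  qed
  also have "(\<Sum>j\<le>n. exp (((c + real j) * w)\<^sup>2 * 1\<^sup>2 / 2) * (real (n choose j) * q ^ j * (1 - q) ^ (n - j)))
      = (\<Sum>j\<le>n. real (n choose j) * q ^ j * (1 - q) ^ (n - j) * exp ((c + real j)\<^sup>2 / (2 * v)))"
    by (intro sum.cong refl) (simp add: power_mult_distrib w2)
  finally show ?thesis .
qed


section \<open>Numerical bounds for the exponential function\<close>

lemma exp_inverse_10_ge: "exp (1 / 10 :: real) \<ge> 1105 / 1000"
  using exp_lower_Taylor_quadratic[of "1 / 10 :: real"] by (simp add: power2_eq_square)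

lemma inverse_exp_1_le: "1 / exp (1::real) \<le> 37 / 100"
proof -
  have "(2703 / 1000 :: real) \<le> (1105 / 1000) ^ 10" by (simp add: field_simps)
  also have "\<dots> \<le> exp (1 / 10) ^ 10"
    by (intro power_mono exp_inverse_10_ge) simp
  also have "\<dots> = exp 1" by (simp flip: exp_of_nat_mult)
  finally show ?thesis by (simp add: field_simps)
qed

text \<open>As 19/10 = 2 - 1/10, an upper bound for e and a lower bound for
  \<open>exp (1 / 10)\<close> suffice. The value 67/10 is small enough for its quotient by 3/4 to
  stay below 3^2, which is how it is used next.\<close>

lemma exp_19_10_le: "exp (19 / 10 :: real) \<le> 67 / 10"
proof -
  have "(1105 / 1000) * exp (19 / 10) \<le> exp (1 / 10 :: real) * exp (19 / 10)"
    by (intro mult_right_mono exp_inverse_10_ge) simp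
  also have "\<dots> = exp 1 ^ 2"
    by (simp flip: exp_add exp_of_nat_mult)
  also have "\<dots> \<le> (272 / 100)\<^sup>2"
    using e_less_272 by (intro power_mono) auto
  also have "\<dots> \<le> (1105 / 1000) * (67 / 10)"
    by (simp add: power2_eq_square)
  finally show ?thesis by simp
qed

text \<open>With k = j + 2 the product (j + 1) (j + 2) is k (k - 1), and \<open>n\<close> stands for
  a - 2. Completing the square gives (j + 3/2)^2 - 1/4, so the quadratic estimate applies with c =
  3/2. In the scale w = 1 / sqrt v the mean n q w is at most (37/100) (1 - w^2) by the cap on q,
  hence bounded uniformly in v.\<close>

lemma binomial_exp_shifted_quadratic_le_3:
  fixes q v :: real and n :: nat
  assumes q: "0 \<le> q" "q \<le> 1" and v: "v \<ge> 2" and n: "real n \<le> v - 1"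
    and qv: "q \<le> 1 / (exp 1 * sqrt v)"
  shows "(\<Sum>j\<le>n. real (n choose j) * q ^ j * (1 - q) ^ (n - j)
           * exp (real ((j + 1) * (j + 2)) / (2 * v))) \<le> 3"
proof -
  define w where "w = 1 / sqrt v"
  have w: "0 \<le> w" "w\<^sup>2 = 1 / v" "w\<^sup>2 \<le> 1 / 2" using v by (auto simp: w_def power_divide)
  \<comment> \<open>\<open>r\<close> is the value of 1 - n / (4 v) at the extreme case n = v -
    1.\<close>
  define r where "r = (3 + w\<^sup>2) / 4"
  define b where "b = (3 / 2 + real n * q) * w"
  have r: "r > 0" "r \<ge> 3 / 4" by (auto simp: r_def add_pos_nonneg)
  have nw: "real n * w\<^sup>2 \<le> 1 - w\<^sup>2"
    using mult_right_mono[OF n, of "w\<^sup>2"] v by (simp add: w diff_divide_distrib)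
  have rn: "r \<le> 1 - real n / (4 * v)" using nw by (simp add: r_def w(2))
  have "q \<le> 37 / 100 * w"
    using qv mult_right_mono[OF inverse_exp_1_le w(1)] by (simp add: w_def)
  then have "real n * q * w \<le> real n * (37 / 100 * w) * w"
    by (intro mult_right_mono mult_left_mono w) auto
  also have "\<dots> \<le> 37 / 100 * (1 - w\<^sup>2)"
    using nw by (simp add: power2_eq_square algebra_simps)
  finally have b: "b \<le> 3 / 2 * w + 37 / 100 * (1 - w\<^sup>2)" by (simp add: b_def algebra_simps)
  have b0: "b \<ge> 0" using w q by (simp add: b_def)
  have "b\<^sup>2 \<le> (3 / 2 * w + 37 / 100 * (1 - w\<^sup>2))\<^sup>2"
    using b b0 by (intro power_mono)
  also have "\<dots> \<le> 2643 / 1000 * w\<^sup>2 + 922 / 1000 * (1 - w\<^sup>2)\<^sup>2"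
  proof -
    have "(3 / 2 * w + 37 / 100 * z)\<^sup>2 \<le> 2643 / 1000 * w\<^sup>2 + 922 / 1000 * z\<^sup>2" for z
    proof -
      \<comment> \<open>Weighted AM-GM for the cross term: twice the product of the coefficients
        1253/2000 and 1110/1253 is exactly 111/100 = 2 (3/2) (37/100).\<close>
      have "0 \<le> (w * (1253 / 2000) - z * (1110 / 1253))\<^sup>2" by simp
      also have "\<dots> = 1570009 / 4000000 * w\<^sup>2 - 111 / 100 * (w * z) + 1232100 / 1570009 * z\<^sup>2"
        by (simp add: power2_eq_square algebra_simps)
      finally have "111 / 100 * (w * z) \<le> 393 / 1000 * w\<^sup>2 + 785 / 1000 * z\<^sup>2"
        using zero_le_power2[of w] zero_le_power2[of z] by linarith
      moreover have "(3 / 2 * w + 37 / 100 * z)\<^sup>2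
          = 9 / 4 * w\<^sup>2 + 111 / 100 * (w * z) + 1369 / 10000 * z\<^sup>2"
        by (simp add: power2_eq_square algebra_simps)
      ultimately show ?thesis
        using zero_le_power2[of z] by linarith
    qed
    then show ?thesis .
  qed
  also have "\<dots> \<le> 19 / 10 * r"
  proof -
    \<comment> \<open>From w^2 \<le> 1/2 the fourth power is at most w^2 / 2, which leaves a linear
      inequality in w^2.\<close>
    have "w\<^sup>2 * w\<^sup>2 \<le> w\<^sup>2 * (1 / 2)" using w v by (intro mult_left_mono) auto
    moreover have "(1 - w\<^sup>2)\<^sup>2 = 1 - 2 * w\<^sup>2 + w\<^sup>2 * w\<^sup>2"
      by (simp add: power2_eq_square[of "1 - w\<^sup>2"] algebra_simps)
    moreover have "2643 / 1000 * W + 922 / 1000 * Z \<le> 19 / 10 * ((3 + W) / 4)"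
      if "Q \<le> W * (1 / 2)" "Z = 1 - 2 * W + Q" "W \<le> 1 / 2" for W Z Q :: real
      using that by (simp add: field_simps)
    ultimately show ?thesis using w(3) unfolding r_def by blast
  qed
  finally have br: "b\<^sup>2 / r \<le> 19 / 10" using r by (simp add: field_simps)
  have eqv: "(3 / 2 + real n * q)\<^sup>2 / (2 * (v - real n / 4)) = b\<^sup>2 / (2 * (1 - real n / (4 * v)))"
  proof -
    have "b\<^sup>2 / (2 * (1 - real n / (4 * v))) = (3 / 2 + real n * q)\<^sup>2 / (v * (2 * (1 - real n / (4 * v))))"
      by (simp add: b_def power_mult_distrib w)
    also have "v * (2 * (1 - real n / (4 * v))) = 2 * (v - real n / 4)"
      using v by (simp add: field_simps)
    finally show ?thesis by simp
  qed
  have "(\<Sum>j\<le>n. real (n choose j) * q ^ j * (1 - q) ^ (n - j)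
           * exp (real ((j + 1) * (j + 2)) / (2 * v)))
     \<le> (\<Sum>j\<le>n. real (n choose j) * q ^ j * (1 - q) ^ (n - j) * exp ((3 / 2 + real j)\<^sup>2 / (2 * v)))"
    using q v by (intro sum_mono mult_left_mono)
      (auto intro!: divide_right_mono simp: power2_eq_square algebra_simps)
  also have "\<dots> \<le> exp (b\<^sup>2 / (2 * (1 - real n / (4 * v)))) / sqrt (1 - real n / (4 * v))"
    using binomial_exp_quadratic_le[OF q, of v n "3 / 2"] n v unfolding eqv by simp
  also have "\<dots> \<le> exp (b\<^sup>2 / (2 * r)) / sqrt r"
    using rn r by (intro frac_le) (auto intro!: divide_left_mono)
  also have "\<dots> \<le> 3"
  proof -
    have "(exp (b\<^sup>2 / (2 * r)) / sqrt r)\<^sup>2 = exp (b\<^sup>2 / r) / r"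
      using r by (simp add: power_divide exp_of_nat_mult[symmetric])
    also have "\<dots> \<le> (67 / 10) / (3 / 4)"
    proof (rule frac_le)
      have "exp (b\<^sup>2 / r) \<le> exp (19 / 10)" using br by simp
      then show "exp (b\<^sup>2 / r) \<le> 67 / 10" using exp_19_10_le by linarith
    qed (use r in auto)
    also have "\<dots> \<le> 3\<^sup>2" by simp
    finally show ?thesis by (rule power2_le_imp_le) simp
  qed
  finally show ?thesis .
qed

text \<open>The trapezoidal rule overestimates the integral of the convex function
  \<open>exp\<close> over [0, w]. Averaging the endpoint values 1 and e^w, instead of taking e^w
  alone, is what lets an exponential moment of 3 suffice later.\<close>

lemma exp_minus_1_le_trapezoid:
  fixes w :: real
  assumes "w \<ge> 0"
  shows "exp w - 1 \<le> w * (1 + exp w) / 2"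
proof -
  define F where "F = (\<lambda>w::real. w * (1 + exp w) / 2 - exp w + 1)"
  have "F 0 \<le> F w"
  proof (rule DERIV_nonneg_imp_nondecreasing[OF assms])
    fix x :: real
    assume "0 \<le> x" "x \<le> w"
    have "(F has_real_derivative ((1 + exp x) + x * exp x) / 2 - exp x) (at x)"
      unfolding F_def by (auto intro!: derivative_eq_intros)
    moreover have "exp x * (1 + (- x)) \<le> exp x * exp (- x)"
      by (intro mult_left_mono exp_ge_add_one_self) auto
    then have "0 \<le> ((1 + exp x) + x * exp x) / 2 - exp x"
      by (simp add: exp_minus algebra_simps)
    ultimately show "\<exists>y. (F has_real_derivative y) (at x) \<and> 0 \<le> y" by blast
  qed
  then show ?thesis by (simp add: F_def)
qed

text \<open>Absorbing k (k - 1) into the binomial coefficient twice shifts both indices by two; the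
  terms k = 0 and k = 1 vanish. This is the source of the factor q^2. Writing the order as
  \<open>Suc (Suc n)\<close> avoids truncated subtraction.\<close>

lemma binomial_second_factorial_moment:
  fixes q :: real and F :: "nat \<Rightarrow> real"
  shows "(\<Sum>k\<le>Suc (Suc n). real (Suc (Suc n) choose k) * q ^ k * (1 - q) ^ (Suc (Suc n) - k)
            * (real (k * (k - 1)) * F k))
       = real (Suc (Suc n) * Suc n) * q\<^sup>2
           * (\<Sum>j\<le>n. real (n choose j) * q ^ j * (1 - q) ^ (n - j) * F (Suc (Suc j)))"
proof -
  have choose: "real (Suc (Suc n) choose Suc (Suc j)) * real (Suc (Suc j) * Suc j)
      = real (Suc (Suc n) * Suc n) * real (n choose j)" for j
  proof -
    have "Suc (Suc j) * (Suc (Suc n) choose Suc (Suc j)) = Suc (Suc n) * (Suc n choose Suc j)"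
      by (rule Suc_times_binomial)
    moreover have "Suc j * (Suc n choose Suc j) = Suc n * (n choose j)"
      by (rule Suc_times_binomial)
    ultimately have "(Suc (Suc n) choose Suc (Suc j)) * (Suc (Suc j) * Suc j)
        = Suc (Suc n) * Suc n * (n choose j)"
      by (metis (no_types, lifting) mult.assoc mult.commute)
    then show ?thesis by (metis of_nat_mult)
  qed
  have "(\<Sum>k\<le>Suc (Suc n). real (Suc (Suc n) choose k) * q ^ k * (1 - q) ^ (Suc (Suc n) - k)
            * (real (k * (k - 1)) * F k))
      = (\<Sum>j\<le>n. real (Suc (Suc n) choose Suc (Suc j)) * q ^ Suc (Suc j) * (1 - q) ^ (n - j)
            * (real (Suc (Suc j) * Suc j) * F (Suc (Suc j))))"
    unfolding sum.atMost_Suc_shift by (simp del: binomial_Suc_Suc)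
  also have "\<dots> = (\<Sum>j\<le>n. (real (Suc (Suc n) choose Suc (Suc j)) * real (Suc (Suc j) * Suc j))
            * (q\<^sup>2 * q ^ j * (1 - q) ^ (n - j) * F (Suc (Suc j))))"
    by (intro sum.cong refl) (simp add: power2_eq_square algebra_simps del: binomial_Suc_Suc)
  also have "\<dots> = real (Suc (Suc n) * Suc n) * q\<^sup>2
           * (\<Sum>j\<le>n. real (n choose j) * q ^ j * (1 - q) ^ (n - j) * F (Suc (Suc j)))"
    unfolding choose sum_distrib_left by (intro sum.cong refl) (simp add: mult_ac)
  finally show ?thesis .
qed

text \<open>\<open>\<integral> ((1 - q) + q L)\<^sup>a d\<phi>\<close> for a centred Gaussian \<open>\<phi>\<close> of standard deviation \<open>\<tau>\<close> and the likelihood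
  ratio \<open>L\<close> of its translate by \<open>g\<close>, where \<open>u = \<parallel>g\<parallel>\<^sup>2 / \<tau>\<^sup>2\<close>.\<close>

definition subsampled_moment :: "real \<Rightarrow> nat \<Rightarrow> real \<Rightarrow> real" where
  "subsampled_moment q a u =
     (\<Sum>k\<le>a. real (a choose k) * q ^ k * (1 - q) ^ (a - k) * exp (real (k * (k - 1)) * u / 2))"

lemma subsampled_moment_le:
  fixes q u v :: real and a :: nat
  assumes q: "0 \<le> q" "q \<le> 1" and v: "v \<ge> 2" and u: "u \<le> 1 / v"
    and a: "v \<le> real a" "real a \<le> v + 1"
    and qv: "q \<le> 1 / (exp 1 * sqrt v)"
  shows "subsampled_moment q a u \<le> 1 + q\<^sup>2 * (2 * real a - v)"
proof -
  obtain n where n: "a = Suc (Suc n)"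
    using v a(1) by (metis One_nat_def Suc_1 add_2_eq_Suc le_Suc_ex of_nat_le_iff of_nat_numeral order_trans)
  define p where "p = (\<lambda>k. real (a choose k) * q ^ k * (1 - q) ^ (a - k))"
  have p: "p k \<ge> 0" for k using q by (simp add: p_def)
  have sum_p: "(\<Sum>k\<le>m. real (m choose k) * q ^ k * (1 - q) ^ (m - k)) = 1" for m
    using binomial_ring[of q "1 - q" m] by simp
  \<comment> \<open>\<open>F\<close> is the trapezoid bound at k (k - 1) / (2 v) with the factor k
    (k - 1) taken out.\<close>
  define F where "F = (\<lambda>k. (1 + exp (real (k * (k - 1)) / (2 * v))) / (4 * v))"
  have "subsampled_moment q a u \<le> (\<Sum>k\<le>a. p k * exp (real (k * (k - 1)) / (2 * v)))"
    unfolding subsampled_moment_def p_def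
  proof (intro sum_mono mult_left_mono)
    fix k
    have "real (k * (k - 1)) * u / 2 \<le> real (k * (k - 1)) * (1 / v) / 2"
      using u by (intro divide_right_mono mult_left_mono) auto
    then show "exp (real (k * (k - 1)) * u / 2) \<le> exp (real (k * (k - 1)) / (2 * v))" by simp
  qed (use q in auto)
  also have "\<dots> \<le> (\<Sum>k\<le>a. p k * (1 + real (k * (k - 1)) * F k))"
  proof (intro sum_mono mult_left_mono p)
    fix k
    have "exp (real (k * (k - 1)) / (2 * v)) - 1 \<le> real (k * (k - 1)) / (2 * v)
        * (1 + exp (real (k * (k - 1)) / (2 * v))) / 2"
      using v by (intro exp_minus_1_le_trapezoid) auto
    then show "exp (real (k * (k - 1)) / (2 * v)) \<le> 1 + real (k * (k - 1)) * F k"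
      by (simp add: F_def)
  qed
  also have "\<dots> = 1 + (\<Sum>k\<le>a. p k * (real (k * (k - 1)) * F k))"
    using sum_p[of a] by (simp add: p_def distrib_left sum.distrib)
  also have "(\<Sum>k\<le>a. p k * (real (k * (k - 1)) * F k))
      = real (Suc (Suc n) * Suc n) * q\<^sup>2
           * (\<Sum>j\<le>n. real (n choose j) * q ^ j * (1 - q) ^ (n - j) * F (Suc (Suc j)))"
    unfolding p_def n by (rule binomial_second_factorial_moment)
  also have "\<dots> \<le> real (Suc (Suc n) * Suc n) * q\<^sup>2 * (1 / v)"
  proof (intro mult_left_mono)
    have "(\<Sum>j\<le>n. real (n choose j) * q ^ j * (1 - q) ^ (n - j) * F (Suc (Suc j)))
        = (\<Sum>j\<le>n. real (n choose j) * q ^ j * (1 - q) ^ (n - j)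
             + real (n choose j) * q ^ j * (1 - q) ^ (n - j) * exp (real ((j + 1) * (j + 2)) / (2 * v)))
           / (4 * v)"
      unfolding sum_divide_distrib
      by (intro sum.cong refl) (simp add: F_def field_simps)
    also have "\<dots> \<le> (1 + 3) / (4 * v)"
      unfolding sum.distrib sum_p using v a n
      by (intro divide_right_mono add_left_mono binomial_exp_shifted_quadratic_le_3 q qv) auto
    finally show "(\<Sum>j\<le>n. real (n choose j) * q ^ j * (1 - q) ^ (n - j) * F (Suc (Suc j))) \<le> 1 / v"
      by simp
  qed simp
  also have "\<dots> = q\<^sup>2 * (real a * (real a - 1) / v)"
    by (simp add: n add_divide_distrib algebra_simps)
  \<comment> \<open>Cleared of denominators this reads (a - v)^2 \<le> a. The left side is at most 1
    because a is v rounded up.\<close>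
  also have "real a * (real a - 1) / v \<le> 2 * real a - v"
  proof -
    have "(real a - v)\<^sup>2 \<le> 1"
      using a by (simp add: power_le_one)
    then have "real a * (real a - 1) \<le> (2 * real a - v) * v"
      using a v by (simp add: power2_eq_square algebra_simps)
    then show ?thesis using v by (simp add: divide_le_eq)
  qed
  finally show ?thesis by (simp add: mult_left_mono)
qed

subsection \<open>The subsampled Gaussian\<close>

text \<open>The difference of the two sides factors as (A^k - B^k) (1 - 1 / (A B)^k). Monotonicity
  of t + 1/t alone would not do, since B may lie below 1.\<close>

lemma power_add_inverse_power_mono:
  fixes A B :: real
  assumes "A > 0" "B > 0" "A * B \<ge> 1" "A \<ge> B"
  shows "B ^ k + 1 / B ^ k \<le> A ^ k + 1 / A ^ k"
proof -
  have "B ^ k \<le> A ^ k" using assms by (intro power_mono) auto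
  moreover have "1 \<le> (A * B) ^ k" using assms(3) by (rule one_le_power)
  ultimately have "0 \<le> (A ^ k - B ^ k) * (1 - 1 / (A * B) ^ k)"
    by (intro mult_nonneg_nonneg) auto
  also have "\<dots> = (A ^ k + 1 / A ^ k) - (B ^ k + 1 / B ^ k)"
    using assms(1,2) by (simp add: power_mult_distrib field_simps)
  finally show ?thesis by simp
qed

text \<open>This is the pointwise core of the reflection argument. The terms with B are the
  reflections of those with A: L turns into 1 / L and the density gains a factor L. The pairing is
  essential, because 1 / A^m exceeds A^(m+1) wherever A < 1.\<close>

lemma mixture_ratio_power_le:
  fixes q L :: real
  assumes q: "0 \<le> q" "q \<le> 1" and L: "L > 0"
  defines "A \<equiv> 1 - q + q * L" and "B \<equiv> 1 - q + q / L"
  shows "1 / A ^ m + L / B ^ m \<le> A ^ Suc m + L * B ^ Suc m"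
proof -
  have pos: "1 - q + q * t > 0" if "t > 0" for t
  proof (cases "q = 0")
    case False
    then show ?thesis using q that by (intro add_nonneg_pos mult_pos_pos) auto
  qed simp
  have A: "A > 0" using pos[OF L] by (simp add: A_def)
  have B: "B > 0" using pos[of "1 / L"] L by (simp add: B_def)
  have eq: "L * (B - 1) = - (A - 1)" using L by (simp add: A_def B_def field_simps)
  have "0 \<le> q * (1 - q) * ((L - 1)\<^sup>2 / L)" using q L by simp
  also have "\<dots> = A * B - 1"
    using L by (simp add: A_def B_def power2_eq_square field_simps)
  finally have AB: "A * B \<ge> 1" by simp
  \<comment> \<open>The case m = 0 is an equality, as A - 1 and L (B - 1) cancel. Passing from m to
    m + 1 changes the right side minus the left by (A - 1) ((A^k + 1/A^k) - (B^k + 1/B^k)) with k =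
    m + 1; both factors are nonnegative for L \<ge> 1 and nonpositive for L < 1.\<close>
  show ?thesis
  proof (induction m)
    case 0
    show ?case using eq by (simp add: algebra_simps)
  next
    case (Suc m)
    define k where "k = Suc m"
    have "0 \<le> (A - 1) * ((A ^ k + 1 / A ^ k) - (B ^ k + 1 / B ^ k))"
    proof (cases "L \<ge> 1")
      case True
      have "A \<ge> 1" using True q mult_left_mono[of 1 L q] by (simp add: A_def)
      moreover have "1 / L \<le> L" using True divide_le_eq_1[of 1 L] by linarith
      then have "q * (1 / L) \<le> q * L" using q by (intro mult_left_mono)
      then have "A \<ge> B" by (simp add: A_def B_def)
      ultimately show ?thesis
        using power_add_inverse_power_mono[OF A B AB, of k] by (intro mult_nonneg_nonneg) auto
    next
      case False
      have "A \<le> 1" using False q mult_left_mono[of L 1 q] by (simp add: A_def)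
      moreover have "1 \<le> 1 / L" using False L by simp
      with False have "L \<le> 1 / L" by linarith
      then have "q * L \<le> q * (1 / L)" using q by (intro mult_left_mono)
      then have "B \<ge> A" by (simp add: A_def B_def)
      ultimately show ?thesis
        using power_add_inverse_power_mono[OF B A, of k] AB
        by (intro mult_nonpos_nonpos) (auto simp: mult.commute)
    qed
    also have "\<dots> = (A - 1) * (A ^ k + 1 / A ^ k) + L * (B - 1) * (B ^ k + 1 / B ^ k)"
      unfolding eq by (simp add: algebra_simps diff_divide_distrib)
    also have "\<dots> = (A ^ Suc k + L * B ^ Suc k - (1 / A ^ k + L / B ^ k))
        - (A ^ Suc m + L * B ^ Suc m - (1 / A ^ m + L / B ^ m))"
      using A B by (simp add: k_def field_simps)
    finally show ?case using Suc.IH by (simp add: k_def)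
  qed
qed

text \<open>The power t^(m+1) lies above its tangent at r. Multiplying the gap for m by t and adding
  (m + 1) r^m (t - r)^2 gives exactly the gap for m + 1.\<close>

lemma power_tangent_le:
  fixes r t :: real
  assumes "r \<ge> 0" "t \<ge> 0"
  shows "real (Suc m) * r ^ m * t \<le> t ^ Suc m + real m * r ^ Suc m"
proof (induction m)
  case (Suc m)
  have "0 \<le> t * (t ^ Suc m + real m * r ^ Suc m - real (Suc m) * r ^ m * t)
      + real (Suc m) * r ^ m * (t - r)\<^sup>2"
    using Suc assms by (intro add_nonneg_nonneg mult_nonneg_nonneg) auto
  also have "\<dots> = t ^ Suc (Suc m) + real (Suc m) * r ^ Suc (Suc m) - real (Suc (Suc m)) * r ^ Suc m * t"
    by (simp add: power2_eq_square algebra_simps)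
  finally show ?case by simp
qed simp

text \<open>Jensen's inequality for the perspective function x^(m+1) / y^m. It dominates every
  linear function (m + 1) r^m x - m r^(m+1) y, with equality where x / y = r; choosing r as the
  ratio of the two weighted sums makes the left-hand side exact.\<close>

lemma sum_power_div_power_le:
  fixes w x y :: "'i \<Rightarrow> real"
  assumes w: "\<And>i. i \<in> I \<Longrightarrow> w i \<ge> 0" and x: "\<And>i. i \<in> I \<Longrightarrow> x i \<ge> 0" and y: "\<And>i. i \<in> I \<Longrightarrow> y i > 0"
    and Y: "(\<Sum>i\<in>I. w i * y i) > 0"
  shows "(\<Sum>i\<in>I. w i * x i) ^ Suc m / (\<Sum>i\<in>I. w i * y i) ^ m
       \<le> (\<Sum>i\<in>I. w i * (x i ^ Suc m / y i ^ m))"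
proof -
  define X Y r where "X = (\<Sum>i\<in>I. w i * x i)" and "Y = (\<Sum>i\<in>I. w i * y i)" and "r = X / Y"
  have X: "X \<ge> 0" using w x by (auto simp: X_def intro!: sum_nonneg)
  have Y: "Y > 0" using Y by (simp add: Y_def)
  have r: "r \<ge> 0" using X Y by (simp add: r_def)
  have "X ^ Suc m / Y ^ m = real (Suc m) * r ^ m * X - real m * r ^ Suc m * Y"
    using Y by (simp add: r_def power_divide field_simps)
  also have "\<dots> = (\<Sum>i\<in>I. w i * (real (Suc m) * r ^ m * x i - real m * r ^ Suc m * y i))"
    by (simp add: X_def Y_def sum_distrib_left right_diff_distrib sum_subtractf mult_ac)
  also have "\<dots> \<le> (\<Sum>i\<in>I. w i * (x i ^ Suc m / y i ^ m))"
  proof (intro sum_mono mult_left_mono w)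
    fix i assume i: "i \<in> I"
    have "real (Suc m) * r ^ m * (x i / y i) \<le> (x i / y i) ^ Suc m + real m * r ^ Suc m"
      using x[OF i] y[OF i] r by (intro power_tangent_le) auto
    then have "real (Suc m) * r ^ m * ((x i / y i) * y i)
        \<le> ((x i / y i) ^ Suc m + real m * r ^ Suc m) * y i"
      unfolding mult.assoc[symmetric] using y[OF i] by (intro mult_right_mono) auto
    moreover have "(x i / y i) ^ Suc m * y i = x i ^ Suc m / y i ^ m"
      using y[OF i] by (simp add: power_divide)
    moreover have "(x i / y i) * y i = x i"
      using y[OF i] by simp
    ultimately show "real (Suc m) * r ^ m * x i - real m * r ^ Suc m * y i \<le> x i ^ Suc m / y i ^ m"
      by (simp only: distrib_right)
  qed
  finally show ?thesis by (simp add: X_def Y_def)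
qed

section \<open>Gaussian densities and Lebesgue integrals\<close>

definition gauss_density :: "real \<Rightarrow> real ^ 'm::finite \<Rightarrow> real" where
  "gauss_density \<tau> x = (\<Prod>j\<in>UNIV. normal_density 0 \<tau> (x $ j))"

lemma gauss_density_measurable [measurable]: "gauss_density \<tau> \<in> borel_measurable borel"
  unfolding gauss_density_def by measurable

lemma gauss_density_pos: "\<tau> > 0 \<Longrightarrow> gauss_density \<tau> x > 0"
  unfolding gauss_density_def by (intro prod_pos) (auto intro: normal_density_pos)

lemma gaussian_noise_altdef:
  "gaussian_noise \<tau> = density lborel (\<lambda>x. ennreal (gauss_density \<tau> x))"
  by (simp add: gaussian_noise_def gauss_density_def)

lemma gauss_density_translate:
  fixes x g :: "real ^ 'm::finite"
  assumes "\<tau> > 0"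
  shows "gauss_density \<tau> (x - g) = gauss_density \<tau> x * exp ((x \<bullet> g - (norm g)\<^sup>2 / 2) / \<tau>\<^sup>2)"
proof -
  have "normal_density 0 \<tau> ((x - g) $ j)
      = normal_density 0 \<tau> (x $ j) * exp ((x $ j * g $ j - (g $ j)\<^sup>2 / 2) / \<tau>\<^sup>2)" for j
    using assms
    by (simp add: normal_density_def exp_add[symmetric]) (simp add: power2_eq_square field_simps)
  then have "gauss_density \<tau> (x - g)
      = gauss_density \<tau> x * exp (\<Sum>j\<in>UNIV. (x $ j * g $ j - (g $ j)\<^sup>2 / 2) / \<tau>\<^sup>2)"
    by (simp add: gauss_density_def prod.distrib exp_sum)
  also have "(\<Sum>j\<in>UNIV. (x $ j * g $ j - (g $ j)\<^sup>2 / 2) / \<tau>\<^sup>2) = (x \<bullet> g - (norm g)\<^sup>2 / 2) / \<tau>\<^sup>2"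
    by (simp add: inner_vec_def dot_square_norm[symmetric] sum_subtractf
        flip: sum_divide_distrib) (simp add: power2_eq_square)
  finally show ?thesis .
qed

lemma nn_integral_gauss_density_exp:
  fixes g :: "real ^ 'm::finite"
  assumes \<tau>: "\<tau> > 0"
  shows "(\<integral>\<^sup>+x. ennreal (gauss_density \<tau> x * exp (c * (x \<bullet> g))) \<partial>lborel)
       = ennreal (exp (c\<^sup>2 * (norm g)\<^sup>2 * \<tau>\<^sup>2 / 2))"
proof -
  have Basis: "(Basis :: (real ^ 'm) set) = range (\<lambda>i. axis i 1)"
    by (auto simp: Basis_vec_def)
  have inj: "inj (\<lambda>i::'m. axis i (1::real))"
    by (auto simp: inj_def axis_eq_axis)
  have "gauss_density \<tau> x * exp (c * (x \<bullet> g))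
      = (\<Prod>b\<in>Basis. normal_density 0 \<tau> (x \<bullet> b) * exp (c * (g \<bullet> b) * (x \<bullet> b)))" for x :: "real ^ 'm"
  proof -
    have "exp (c * (x \<bullet> g)) = (\<Prod>j\<in>UNIV. exp (c * g $ j * x $ j))"
      by (simp add: inner_vec_def sum_distrib_left mult_ac flip: exp_sum)
    then show ?thesis
      by (simp add: Basis prod.reindex[OF inj] gauss_density_def inner_axis prod.distrib)
  qed
  then have "(\<integral>\<^sup>+x. ennreal (gauss_density \<tau> x * exp (c * (x \<bullet> g))) \<partial>lborel)
     = (\<integral>\<^sup>+x. (\<Prod>b\<in>Basis. ennreal (normal_density 0 \<tau> (x \<bullet> b) * exp (c * (g \<bullet> b) * (x \<bullet> b)))) \<partial>lborel)"
    by (simp add: prod_ennreal)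
  also have "\<dots> = (\<Prod>b\<in>Basis. \<integral>\<^sup>+x. ennreal (normal_density 0 \<tau> x * exp (c * (g \<bullet> b) * x)) \<partial>lborel)"
    by (rule nn_integral_lborel_prod) auto
  also have "\<dots> = (\<Prod>b\<in>Basis. ennreal (exp ((c * (g \<bullet> b))\<^sup>2 * \<tau>\<^sup>2 / 2)))"
  proof (intro prod.cong refl)
    fix b :: "real ^ 'm"
    note h = has_bochner_integral_normal_exp[OF \<tau>, of "c * (g \<bullet> b)"]
    show "(\<integral>\<^sup>+x. ennreal (normal_density 0 \<tau> x * exp (c * (g \<bullet> b) * x)) \<partial>lborel)
        = ennreal (exp ((c * (g \<bullet> b))\<^sup>2 * \<tau>\<^sup>2 / 2))"
      using nn_integral_eq_integral[OF integrable.intros[OF h]]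
      unfolding has_bochner_integral_integral_eq[OF h] by simp
  qed
  also have "\<dots> = ennreal (exp (\<Sum>b\<in>Basis. (c * (g \<bullet> b))\<^sup>2 * \<tau>\<^sup>2 / 2))"
    by (simp add: prod_ennreal exp_sum)
  also have "(\<Sum>b\<in>Basis. (c * (g \<bullet> b))\<^sup>2 * \<tau>\<^sup>2 / 2) = c\<^sup>2 * (\<Sum>b\<in>Basis. (g \<bullet> b)\<^sup>2) * \<tau>\<^sup>2 / 2"
    by (simp add: power_mult_distrib sum_distrib_left sum_distrib_right sum_divide_distrib)
  also have "(\<Sum>b\<in>Basis. (g \<bullet> b)\<^sup>2) = (norm g)\<^sup>2"
    unfolding power2_norm_eq_inner by (subst euclidean_inner) (simp add: power2_eq_square)
  finally show ?thesis .
qed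

lemma nn_integral_lborel_translate:
  fixes f :: "'a::euclidean_space \<Rightarrow> ennreal"
  assumes [measurable]: "f \<in> borel_measurable borel"
  shows "(\<integral>\<^sup>+x. f (x - c) \<partial>lborel) = (\<integral>\<^sup>+x. f x \<partial>lborel)"
proof -
  have "(\<integral>\<^sup>+x. f x \<partial>lborel) = (\<integral>\<^sup>+x. f x \<partial>distr lborel borel ((+) (- c)))"
    by (simp add: lborel_distr_plus)
  also have "\<dots> = (\<integral>\<^sup>+x. f (x - c) \<partial>lborel)"
    by (subst nn_integral_distr) auto
  finally show ?thesis ..
qed

lemma nn_integral_lborel_reflect:
  fixes f :: "'a::euclidean_space \<Rightarrow> ennreal"
  assumes [measurable]: "f \<in> borel_measurable borel"
  shows "(\<integral>\<^sup>+x. f (c - x) \<partial>lborel) = (\<integral>\<^sup>+x. f x \<partial>lborel)"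
proof -
  have "(\<integral>\<^sup>+x. f x \<partial>lborel) = (\<integral>\<^sup>+x. f x \<partial>distr lborel borel (\<lambda>x. c + (- 1) *\<^sub>R x))"
    using lborel_affine[of "- 1" c] by (simp add: density_1)
  also have "\<dots> = (\<integral>\<^sup>+x. f (c - x) \<partial>lborel)"
    by (subst nn_integral_distr) auto
  finally show ?thesis ..
qed

text \<open>With u = |g|^2 / \<tau>^2, the power L^k brings exp (- k u / 2) from its normalisation
  and exp (k^2 u / 2) from the moment generating function at k / \<tau>^2. Together they give the
  exponent k (k - 1) u / 2.\<close>

lemma nn_integral_gauss_mixture:
  fixes g :: "real ^ 'm::finite"
  assumes \<tau>: "\<tau> > 0" and q: "0 \<le> q" "q \<le> 1"
  defines "L \<equiv> \<lambda>x. exp ((x \<bullet> g - (norm g)\<^sup>2 / 2) / \<tau>\<^sup>2)"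
  shows "(\<integral>\<^sup>+x. ennreal (gauss_density \<tau> x * (1 - q + q * L x) ^ a) \<partial>lborel)
      = ennreal (subsampled_moment q a ((norm g)\<^sup>2 / \<tau>\<^sup>2))"
proof -
  define u where "u = (norm g)\<^sup>2 / \<tau>\<^sup>2"
  define d where "d = (\<lambda>k. real (a choose k) * q ^ k * (1 - q) ^ (a - k) * exp (- (real k * u / 2)))"
  have d: "d k \<ge> 0" for k using q by (simp add: d_def)
  have "gauss_density \<tau> x * (1 - q + q * L x) ^ a
     = (\<Sum>k\<le>a. d k * (gauss_density \<tau> x * exp (real k / \<tau>\<^sup>2 * (x \<bullet> g))))" for x
  proof -
    have L: "L x ^ k = exp (- (real k * u / 2)) * exp (real k / \<tau>\<^sup>2 * (x \<bullet> g))" for k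
      by (simp add: L_def u_def diff_divide_distrib right_diff_distrib flip: exp_of_nat_mult exp_add)
    have "(1 - q + q * L x) ^ a = (\<Sum>k\<le>a. real (a choose k) * (q * L x) ^ k * (1 - q) ^ (a - k))"
      using binomial_ring[of "q * L x" "1 - q" a] by (simp add: add.commute)
    then show ?thesis
      by (simp add: sum_distrib_left d_def power_mult_distrib L mult_ac)
  qed
  moreover have "ennreal (\<Sum>k\<le>a. d k * (gauss_density \<tau> x * exp (real k / \<tau>\<^sup>2 * (x \<bullet> g))))
      = (\<Sum>k\<le>a. ennreal (d k) * ennreal (gauss_density \<tau> x * exp (real k / \<tau>\<^sup>2 * (x \<bullet> g))))" for x
    unfolding ennreal_mult'[OF d, symmetric] using d gauss_density_pos[OF \<tau>, THEN less_imp_le]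
    by (intro sum_ennreal[symmetric] mult_nonneg_nonneg) auto
  ultimately have "(\<integral>\<^sup>+x. ennreal (gauss_density \<tau> x * (1 - q + q * L x) ^ a) \<partial>lborel)
      = (\<integral>\<^sup>+x. (\<Sum>k\<le>a. ennreal (d k) * ennreal (gauss_density \<tau> x * exp (real k / \<tau>\<^sup>2 * (x \<bullet> g)))) \<partial>lborel)"
    by (simp only:)
  also have "\<dots> = (\<Sum>k\<le>a. ennreal (d k) * ennreal (exp ((real k / \<tau>\<^sup>2)\<^sup>2 * (norm g)\<^sup>2 * \<tau>\<^sup>2 / 2)))"
    by (subst nn_integral_sum, measurable)
      (simp add: nn_integral_cmult nn_integral_gauss_density_exp[OF \<tau>] del: times_divide_eq_left)
  also have "\<dots> = ennreal (\<Sum>k\<le>a. d k * exp ((real k / \<tau>\<^sup>2)\<^sup>2 * (norm g)\<^sup>2 * \<tau>\<^sup>2 / 2))"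
    unfolding ennreal_mult'[OF d, symmetric] using d by (intro sum_ennreal mult_nonneg_nonneg) auto
  also have "(\<Sum>k\<le>a. d k * exp ((real k / \<tau>\<^sup>2)\<^sup>2 * (norm g)\<^sup>2 * \<tau>\<^sup>2 / 2)) = subsampled_moment q a u"
  proof -
    have "exp (- (real k * u / 2)) * exp ((real k / \<tau>\<^sup>2)\<^sup>2 * (norm g)\<^sup>2 * \<tau>\<^sup>2 / 2)
        = exp (real (k * (k - 1)) * u / 2)" for k
    proof -
      have "(real k / \<tau>\<^sup>2)\<^sup>2 * (norm g)\<^sup>2 * \<tau>\<^sup>2 = real k * real k * u"
        using \<tau> by (simp add: u_def power2_eq_square)
      then have "- (real k * u / 2) + (real k / \<tau>\<^sup>2)\<^sup>2 * (norm g)\<^sup>2 * \<tau>\<^sup>2 / 2 = real (k * (k - 1)) * u / 2"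
        by (cases k) (simp_all add: algebra_simps)
      then show ?thesis by (simp only: exp_add[symmetric])
    qed
    then show ?thesis
      unfolding subsampled_moment_def d_def by (simp only: mult.assoc)
  qed
  finally show ?thesis by (simp add: u_def)
qed

text \<open>On the left is the moment of the reversed comparison, with the mixture in the
  denominator. Both integrals are doubled and one copy of each is reflected; then the integrands can
  be compared by \<open>mixture_ratio_power_le\<close>.\<close>

lemma nn_integral_gauss_mixture_inverse_le:
  fixes g :: "real ^ 'm::finite"
  assumes \<tau>: "\<tau> > 0" and q: "0 \<le> q" "q \<le> 1"
  defines "L \<equiv> \<lambda>x. exp ((x \<bullet> g - (norm g)\<^sup>2 / 2) / \<tau>\<^sup>2)"
  shows "(\<integral>\<^sup>+x. ennreal (gauss_density \<tau> x * (1 / (1 - q + q * L x) ^ m)) \<partial>lborel)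
      \<le> (\<integral>\<^sup>+x. ennreal (gauss_density \<tau> x * (1 - q + q * L x) ^ Suc m) \<partial>lborel)"
proof -
  let ?\<phi> = "gauss_density \<tau> :: real ^ 'm \<Rightarrow> real"
  have [measurable]: "L \<in> borel_measurable borel" unfolding L_def by measurable
  have L: "L x > 0" for x by (simp add: L_def)
  have \<phi>: "?\<phi> x \<ge> 0" for x using gauss_density_pos[OF \<tau>, of x] by simp
  \<comment> \<open>The substitution x -> g - x preserves Lebesgue measure, turns the density at x
    into \<open>?\<phi> x * L x\<close> and inverts the ratio \<open>L x\<close>.\<close>
  have reflect: "(\<integral>\<^sup>+x. ennreal (?\<phi> x * F (L x)) \<partial>lborel)
      = (\<integral>\<^sup>+x. ennreal (?\<phi> x * (L x * F (1 / L x))) \<partial>lborel)"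
    if [measurable]: "F \<in> borel_measurable borel" for F
  proof -
    have "(\<integral>\<^sup>+x. ennreal (?\<phi> x * F (L x)) \<partial>lborel) = (\<integral>\<^sup>+x. ennreal (?\<phi> (g - x) * F (L (g - x))) \<partial>lborel)"
      by (rule nn_integral_lborel_reflect[symmetric]) measurable
    moreover have "?\<phi> (g - x) = ?\<phi> x * L x" for x
    proof -
      have "?\<phi> (g - x) = ?\<phi> (x - g)"
        by (simp add: gauss_density_def normal_density_def power2_commute)
      then show ?thesis by (simp add: gauss_density_translate[OF \<tau>] L_def)
    qed
    moreover have "L (g - x) = 1 / L x" for x
    proof -
      have "L (g - x) * L x = 1"
        unfolding L_def exp_add[symmetric]
        by (simp add: inner_diff_left inner_diff_right power2_norm_eq_inner inner_commute[of x g]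
            add_divide_distrib[symmetric])
      then show ?thesis using L[of x] by (simp add: field_simps)
    qed
    ultimately show ?thesis by (simp add: mult.assoc)
  qed
  define X where "X = (\<integral>\<^sup>+x. ennreal (?\<phi> x * (1 / (1 - q + q * L x) ^ m)) \<partial>lborel)"
  define Y where "Y = (\<integral>\<^sup>+x. ennreal (?\<phi> x * (1 - q + q * L x) ^ Suc m) \<partial>lborel)"
  have nonneg: "1 - q + q * t \<ge> 0" if "t > 0" for t
    using q that by (intro add_nonneg_nonneg) auto
  have plus: "(\<integral>\<^sup>+x. ennreal (F x) \<partial>lborel) + (\<integral>\<^sup>+x. ennreal (G x) \<partial>lborel)
      = (\<integral>\<^sup>+x. ennreal (F x + G x) \<partial>lborel)"
    if [measurable]: "F \<in> borel_measurable borel" "G \<in> borel_measurable borel"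
      and "\<And>x. F x \<ge> 0" "\<And>x. G x \<ge> 0" for F G :: "real ^ 'm \<Rightarrow> real"
    using that by (simp add: nn_integral_add)
  have nonneg': "1 - q + q * (1 / L x) \<ge> 0" for x
    using L by (intro nonneg) simp
  have "X + X = (\<integral>\<^sup>+x. ennreal (?\<phi> x * (1 / (1 - q + q * L x) ^ m)
      + ?\<phi> x * (L x * (1 / (1 - q + q * (1 / L x)) ^ m))) \<partial>lborel)"
  proof -
    have "X + X = X + (\<integral>\<^sup>+x. ennreal (?\<phi> x * (L x * (1 / (1 - q + q * (1 / L x)) ^ m))) \<partial>lborel)"
      unfolding X_def by (subst (2) reflect[of "\<lambda>t. 1 / (1 - q + q * t) ^ m"]) auto
    also have "\<dots> = (\<integral>\<^sup>+x. ennreal (?\<phi> x * (1 / (1 - q + q * L x) ^ m)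
      + ?\<phi> x * (L x * (1 / (1 - q + q * (1 / L x)) ^ m))) \<partial>lborel)"
      unfolding X_def using nonneg[OF L] nonneg'
      by (intro plus mult_nonneg_nonneg \<phi> less_imp_le[OF L] divide_nonneg_nonneg zero_le_power) auto
    finally show ?thesis .
  qed
  also have "\<dots> \<le> (\<integral>\<^sup>+x. ennreal (?\<phi> x * (1 - q + q * L x) ^ Suc m
      + ?\<phi> x * (L x * (1 - q + q * (1 / L x)) ^ Suc m)) \<partial>lborel)"
  proof (intro nn_integral_mono ennreal_leI)
    fix x
    show "?\<phi> x * (1 / (1 - q + q * L x) ^ m) + ?\<phi> x * (L x * (1 / (1 - q + q * (1 / L x)) ^ m))
        \<le> ?\<phi> x * (1 - q + q * L x) ^ Suc m + ?\<phi> x * (L x * (1 - q + q * (1 / L x)) ^ Suc m)"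
      unfolding distrib_left[symmetric]
      using mixture_ratio_power_le[OF q L, of x m] by (intro mult_left_mono \<phi>) simp
  qed
  also have "\<dots> = Y + Y"
  proof -
    have "Y + Y = Y + (\<integral>\<^sup>+x. ennreal (?\<phi> x * (L x * (1 - q + q * (1 / L x)) ^ Suc m)) \<partial>lborel)"
      unfolding Y_def by (subst (2) reflect[of "\<lambda>t. (1 - q + q * t) ^ Suc m"]) auto
    also have "\<dots> = (\<integral>\<^sup>+x. ennreal (?\<phi> x * ((1 - q + q * L x) ^ Suc m)
      + ?\<phi> x * (L x * ((1 - q + q * (1 / L x)) ^ Suc m))) \<partial>lborel)"
      unfolding Y_def using nonneg[OF L] nonneg'
      by (intro plus mult_nonneg_nonneg \<phi> less_imp_le[OF L] divide_nonneg_nonneg zero_le_power) auto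
    finally show ?thesis by (simp only:)
  qed
  finally have "X + X \<le> Y + Y" .
  \<comment> \<open>Cancelling the factor 2, rather than subtracting a copy, is sound in
    \<open>ennreal\<close> even for infinite values.\<close>
  then have "2 * X \<le> 2 * Y" by (simp add: mult_2)
  then have "X \<le> Y" by (subst (asm) ennreal_mult_le_mult_iff) auto
  then show ?thesis by (simp add: X_def Y_def)
qed

text \<open>The output density of a round is a mixture over the samples \<open>J\<close> of the common records; by joint
  convexity of \<open>x\<^sup>a / y\<^sup>a\<^sup>-\<^sup>1\<close> it suffices to compare the two components belonging to the same \<open>J\<close>.\<close>

lemma gauss_mixture_renyi_le:
  fixes \<mu> :: "'j \<Rightarrow> real ^ 'm::finite" and g :: "real ^ 'm"
  assumes \<tau>: "\<tau> > 0" and q: "0 \<le> q" "q \<le> 1"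
    and I: "finite I" and w: "\<And>J. J \<in> I \<Longrightarrow> w J \<ge> 0" "sum w I = 1"
  defines "p0 \<equiv> \<lambda>x. \<Sum>J\<in>I. w J * gauss_density \<tau> (x - \<mu> J)"
    and "p1 \<equiv> \<lambda>x. \<Sum>J\<in>I. w J * ((1 - q) * gauss_density \<tau> (x - \<mu> J) + q * gauss_density \<tau> (x - \<mu> J - g))"
  shows "(\<integral>\<^sup>+x. ennreal (p1 x ^ Suc m / p0 x ^ m) \<partial>lborel)
          \<le> ennreal (subsampled_moment q (Suc m) ((norm g)\<^sup>2 / \<tau>\<^sup>2))" (is ?thesis1)
    and "(\<integral>\<^sup>+x. ennreal (p0 x ^ Suc m / p1 x ^ m) \<partial>lborel)
          \<le> ennreal (subsampled_moment q (Suc m) ((norm g)\<^sup>2 / \<tau>\<^sup>2))" (is ?thesis2)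
proof -
  let ?\<phi> = "gauss_density \<tau> :: real ^ 'm \<Rightarrow> real"
  let ?M = "ennreal (subsampled_moment q (Suc m) ((norm g)\<^sup>2 / \<tau>\<^sup>2))"
  define L where "L = (\<lambda>x. exp ((x \<bullet> g - (norm g)\<^sup>2 / 2) / \<tau>\<^sup>2))"
  define \<phi>1 where "\<phi>1 = (\<lambda>x. (1 - q) * ?\<phi> x + q * ?\<phi> (x - g))"
  have [measurable]: "L \<in> borel_measurable borel" unfolding L_def by measurable
  have [measurable]: "\<phi>1 \<in> borel_measurable borel" unfolding \<phi>1_def by measurable
  have \<phi>: "?\<phi> x > 0" for x using gauss_density_pos[OF \<tau>] .
  have A: "1 - q + q * L x > 0" for x
  proof (cases "q = 0")
    case False
    then show ?thesis using q by (intro add_nonneg_pos mult_pos_pos) (auto simp: L_def)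
  qed simp
  have \<phi>1: "\<phi>1 x = ?\<phi> x * (1 - q + q * L x)" for x
    by (simp add: \<phi>1_def gauss_density_translate[OF \<tau>] L_def algebra_simps)
  have \<phi>1_pos: "\<phi>1 x > 0" for x using \<phi> A by (simp add: \<phi>1)
  have avg: "(\<Sum>J\<in>I. w J * F J) > 0" if "\<And>J. F J > 0" for F :: "'j \<Rightarrow> real"
  proof -
    obtain J where "J \<in> I" "w J > 0"
      using w by (metis less_eq_real_def sum.neutral zero_neq_one)
    then show ?thesis
      using w that I by (intro sum_pos2[of I J]) (auto intro: mult_nonneg_nonneg less_imp_le)
  qed
  \<comment> \<open>After the convexity step each sample J contributes a translate of one fixed
    integrand. By translation invariance the centres \<open>\<mu> J\<close> disappear, and the
    weights sum to 1.\<close>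
  have single: "(\<integral>\<^sup>+x. ennreal (\<Sum>J\<in>I. w J * F (x - \<mu> J)) \<partial>lborel) \<le> ?M"
    if F: "\<And>x. F x \<ge> 0" "F \<in> borel_measurable borel" "(\<integral>\<^sup>+x. ennreal (F x) \<partial>lborel) \<le> ?M" for F
  proof -
    note [measurable] = F(2)
    have "(\<integral>\<^sup>+x. ennreal (\<Sum>J\<in>I. w J * F (x - \<mu> J)) \<partial>lborel)
        = (\<integral>\<^sup>+x. (\<Sum>J\<in>I. ennreal (w J) * ennreal (F (x - \<mu> J))) \<partial>lborel)"
      using w(1) F(1)
      by (intro nn_integral_cong) (simp add: sum_ennreal mult_nonneg_nonneg flip: ennreal_mult)
    also have "\<dots> = (\<Sum>J\<in>I. ennreal (w J) * (\<integral>\<^sup>+x. ennreal (F (x - \<mu> J)) \<partial>lborel))"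
      by (subst nn_integral_sum) (auto simp: nn_integral_cmult)
    also have "\<dots> = (\<Sum>J\<in>I. ennreal (w J) * (\<integral>\<^sup>+x. ennreal (F x) \<partial>lborel))"
      by (subst nn_integral_lborel_translate[of "\<lambda>x. ennreal (F x)"]) auto
    also have "\<dots> \<le> (\<Sum>J\<in>I. ennreal (w J) * ?M)"
      by (intro sum_mono mult_left_mono F) auto
    also have "\<dots> = ?M"
      unfolding sum_distrib_right[symmetric] using w by (simp add: sum_ennreal)
    finally show ?thesis .
  qed
  have p0: "p0 x = (\<Sum>J\<in>I. w J * ?\<phi> (x - \<mu> J))"
    and p1: "p1 x = (\<Sum>J\<in>I. w J * \<phi>1 (x - \<mu> J))" for x
    by (simp_all add: p0_def p1_def \<phi>1_def)
  have "(\<integral>\<^sup>+x. ennreal (p1 x ^ Suc m / p0 x ^ m) \<partial>lborel)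
      \<le> (\<integral>\<^sup>+x. ennreal (\<Sum>J\<in>I. w J * (\<phi>1 (x - \<mu> J) ^ Suc m / ?\<phi> (x - \<mu> J) ^ m)) \<partial>lborel)"
    unfolding p0 p1
    by (intro nn_integral_mono ennreal_leI sum_power_div_power_le w avg \<phi> less_imp_le[OF \<phi>1_pos])
  also have "\<dots> \<le> ?M"
  proof (rule single)
    have "\<phi>1 x ^ Suc m / ?\<phi> x ^ m = ?\<phi> x * (1 - q + q * L x) ^ Suc m" for x
      using \<phi>[of x] by (simp add: \<phi>1 power_mult_distrib del: power_Suc) (simp add: field_simps)
    then show "(\<integral>\<^sup>+x. ennreal (\<phi>1 x ^ Suc m / ?\<phi> x ^ m) \<partial>lborel) \<le> ?M"
      using nn_integral_gauss_mixture[OF \<tau> q, of g "Suc m"] by (simp add: L_def del: power_Suc)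
  qed (use \<phi> \<phi>1_pos in \<open>auto intro: less_imp_le divide_nonneg_pos\<close>)
  finally show ?thesis1 .
  have "(\<integral>\<^sup>+x. ennreal (p0 x ^ Suc m / p1 x ^ m) \<partial>lborel)
      \<le> (\<integral>\<^sup>+x. ennreal (\<Sum>J\<in>I. w J * (?\<phi> (x - \<mu> J) ^ Suc m / \<phi>1 (x - \<mu> J) ^ m)) \<partial>lborel)"
    unfolding p0 p1
    by (intro nn_integral_mono ennreal_leI sum_power_div_power_le w avg \<phi>1_pos less_imp_le[OF \<phi>])
  also have "\<dots> \<le> ?M"
  proof (rule single)
    have "?\<phi> x ^ Suc m / \<phi>1 x ^ m = ?\<phi> x * (1 / (1 - q + q * L x) ^ m)" for x
      using \<phi>[of x] by (simp add: \<phi>1 power_mult_distrib)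
    then show "(\<integral>\<^sup>+x. ennreal (?\<phi> x ^ Suc m / \<phi>1 x ^ m) \<partial>lborel) \<le> ?M"
      using nn_integral_gauss_mixture[OF \<tau> q, of g "Suc m"]
        nn_integral_gauss_mixture_inverse_le[OF \<tau> q, of g m]
      by (simp add: L_def del: power_Suc)
  qed (use \<phi> \<phi>1_pos in \<open>auto intro: less_imp_le divide_nonneg_pos\<close>)
  finally show ?thesis2 .
qed

subsection \<open>Gradients and Poisson sampling\<close>

text \<open>Differentiability does not make the gradient continuous, but each component is a
  pointwise limit of difference quotients of the continuous function \<open>f\<close> with steps 1 /
  (n + 1). Measurability is needed because gradients are evaluated at models that depend on random
  outputs.\<close>

lemma the_gderiv_measurable:
  fixes f :: "'v::euclidean_space \<Rightarrow> real"
  assumes diff: "\<And>w. f differentiable (at w)"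
  shows "(\<lambda>w. THE D. GDERIV f w :> D) \<in> borel_measurable borel"
proof -
  define G where "G = (\<lambda>w. THE D. GDERIV f w :> D)"
  have G: "GDERIV f w :> G w" for w
  proof -
    obtain f' where f': "(f has_derivative f') (at w)"
      using diff[of w] by (auto simp: differentiable_def)
    interpret linear f' using has_derivative_linear[OF f'] .
    have "f' = (\<lambda>h. h \<bullet> (\<Sum>b\<in>Basis. f' b *\<^sub>R b))"
    proof
      fix h
      have "f' h = f' (\<Sum>b\<in>Basis. (h \<bullet> b) *\<^sub>R b)" by (simp add: euclidean_representation)
      then show "f' h = h \<bullet> (\<Sum>b\<in>Basis. f' b *\<^sub>R b)"
        by (simp add: sum scale inner_sum_right mult.commute)
    qed
    then have ex: "GDERIV f w :> (\<Sum>b\<in>Basis. f' b *\<^sub>R b)"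
      using f' unfolding gderiv_def by metis
    have "\<exists>!D. GDERIV f w :> D"
    proof (rule ex1I, rule ex)
      fix D assume "GDERIV f w :> D"
      then have "(\<lambda>h. h \<bullet> D) = (\<lambda>h. h \<bullet> (\<Sum>b\<in>Basis. f' b *\<^sub>R b))"
        using ex unfolding gderiv_def by (rule has_derivative_unique)
      then show "D = (\<Sum>b\<in>Basis. f' b *\<^sub>R b)"
        by (metis vector_eq_ldot)
    qed
    then show ?thesis unfolding G_def by (rule theI')
  qed
  have "continuous_on UNIV f"
    using diff by (simp add: continuous_at_imp_continuous_on differentiable_imp_continuous_within)
  then have [measurable]: "f \<in> borel_measurable borel"
    by (rule borel_measurable_continuous_onI)
  have "(\<lambda>w. G w \<bullet> b) \<in> borel_measurable borel" for b
  proof (rule borel_measurable_LIMSEQ_real)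
    fix w
    have "((\<lambda>t. f (w + t *\<^sub>R b)) has_derivative (\<lambda>t. (t *\<^sub>R b) \<bullet> G w)) (at 0)"
    proof (rule has_derivative_compose[of "\<lambda>t. w + t *\<^sub>R b" _ 0 UNIV f, simplified])
      show "((\<lambda>t. w + t *\<^sub>R b) has_derivative (\<lambda>t. t *\<^sub>R b)) (at 0)"
        by (auto intro!: derivative_eq_intros)
      show "(f has_derivative (\<lambda>h. h \<bullet> G w)) (at w)"
        using G[of w] by (simp add: gderiv_def)
    qed
    then have "((\<lambda>t. f (w + t *\<^sub>R b)) has_real_derivative (G w \<bullet> b)) (at 0)"
      by (simp add: has_field_derivative_def inner_commute mult_commute_abs)
    then have "((\<lambda>t. (f (w + t *\<^sub>R b) - f w) / t) \<longlongrightarrow> G w \<bullet> b) (at 0)"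
      by (simp add: DERIV_def)
    moreover have "filterlim (\<lambda>n. inverse (real (Suc n))) (at 0) sequentially"
      using LIMSEQ_inverse_real_of_nat by (auto simp: filterlim_at)
    ultimately show "(\<lambda>n. (f (w + inverse (real (Suc n)) *\<^sub>R b) - f w) / inverse (real (Suc n)))
        \<longlonglongrightarrow> G w \<bullet> b"
      by (rule filterlim_compose)
  qed measurable
  then have "G \<in> borel_measurable borel"
    by (subst borel_measurable_euclidean_space) auto
  then show ?thesis by (simp add: G_def)
qed

lemma clip_measurable [measurable]:
  "(clip C :: 'v::euclidean_space \<Rightarrow> 'v) \<in> borel_measurable borel"
  unfolding clip_def by measurable

lemma norm_clip_le:
  assumes "C > 0"
  shows "norm (clip C x) \<le> C"
proof -
  have "norm x / C \<le> max 1 (norm x / C)" by simp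
  then have "norm x \<le> C * max 1 (norm x / C)"
    using assms by (metis mult.commute pos_divide_le_eq)
  moreover have "max 1 (norm x / C) > 0" by simp
  ultimately show ?thesis by (simp add: clip_def divide_inverse_commute[symmetric] divide_le_eq)
qed

lemma pmf_poisson_sample:
  assumes D: "finite D" and q: "0 \<le> q" "q \<le> 1" and J: "J \<subseteq> D"
  shows "pmf (poisson_sample q D) J = q ^ card J * (1 - q) ^ card (D - J)"
proof -
  let ?P = "Pi_pmf D False (\<lambda>_. bernoulli_pmf q)"
  have "pmf (poisson_sample q D) J = measure_pmf.prob ?P ((\<lambda>b. {\<xi>\<in>D. b \<xi>}) -` {J})"
    by (simp add: poisson_sample_def pmf_map)
  \<comment> \<open>The preimage also contains functions that are true somewhere outside
    \<open>D\<close>; these have probability 0 because the default value of \<open>Pi_pmf\<close> is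
    \<open>False\<close>.\<close>
  also have "\<dots> = measure_pmf.prob ?P {\<lambda>\<xi>. \<xi> \<in> J}"
  proof (rule measure_prob_cong_0)
    fix b assume b: "b \<in> (\<lambda>b. {\<xi>\<in>D. b \<xi>}) -` {J} - {\<lambda>\<xi>. \<xi> \<in> J}"
    then have "b \<noteq> (\<lambda>\<xi>. \<xi> \<in> {\<xi>\<in>D. b \<xi>})" by auto
    then obtain \<xi> where "b \<xi>" "\<xi> \<notin> D" by (auto simp: fun_eq_iff)
    then show "pmf ?P b = 0" using D by (auto simp: pmf_Pi)
  qed (use J in auto)
  also have "\<dots> = (\<Prod>\<xi>\<in>D. pmf (bernoulli_pmf q) (\<xi> \<in> J))"
    using D J by (auto simp: measure_pmf_single pmf_Pi)
  also have "\<dots> = (\<Prod>\<xi>\<in>J. pmf (bernoulli_pmf q) (\<xi> \<in> J)) * (\<Prod>\<xi>\<in>D - J. pmf (bernoulli_pmf q) (\<xi> \<in> J))"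
    using D J by (metis mult.commute prod.subset_diff)
  also have "\<dots> = q ^ card J * (1 - q) ^ card (D - J)"
    using q by simp
  finally show ?thesis .
qed

lemma set_pmf_poisson_sample: "finite D \<Longrightarrow> set_pmf (poisson_sample q D) \<subseteq> Pow D"
  by (auto simp: poisson_sample_def)

lemma sum_pmf_poisson_sample:
  assumes "finite D"
  shows "(\<Sum>J\<in>Pow D. pmf (poisson_sample q D) J) = 1"
  using assms set_pmf_poisson_sample[OF assms, of q] by (intro sum_pmf_eq_1) auto

text \<open>The extra record is included independently with probability q. Conditioning on its
  inclusion indexes the output densities of both data sets by samples of the common records, the
  form that \<open>gauss_mixture_renyi_le\<close> compares.\<close>

lemma sum_poisson_sample_insert:
  fixes F :: "'x set \<Rightarrow> real"
  assumes D: "finite D" and x: "x \<notin> D" and q: "0 \<le> q" "q \<le> 1"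
  shows "(\<Sum>J\<in>Pow (insert x D). pmf (poisson_sample q (insert x D)) J * F J)
       = (\<Sum>J\<in>Pow D. pmf (poisson_sample q D) J * ((1 - q) * F J + q * F (insert x J)))"
proof -
  have disj: "Pow D \<inter> insert x ` Pow D = {}" using x by auto
  have inj: "inj_on (insert x) (Pow D)"
    using x by (auto simp: inj_on_def)
  have p: "pmf (poisson_sample q (insert x D)) J = (1 - q) * pmf (poisson_sample q D) J"
      "pmf (poisson_sample q (insert x D)) (insert x J) = q * pmf (poisson_sample q D) J"
    if J: "J \<in> Pow D" for J
  proof -
    have fin: "finite J" "finite (D - J)" and xJ: "x \<notin> J"
      using J D x by (auto intro: finite_subset)
    have "insert x D - J = insert x (D - J)" "insert x D - insert x J = D - J"
      using x xJ J by auto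
    then show "pmf (poisson_sample q (insert x D)) J = (1 - q) * pmf (poisson_sample q D) J"
      "pmf (poisson_sample q (insert x D)) (insert x J) = q * pmf (poisson_sample q D) J"
      using J D q fin xJ x by (simp_all add: pmf_poisson_sample subset_insertI2 insert_mono)
  qed
  show ?thesis
    unfolding Pow_insert using D
    by (subst sum.union_disjoint[OF _ _ disj])
      (simp_all add: sum.reindex[OF inj] p sum.distrib[symmetric] algebra_simps)
qed

lemma nn_integral_gauss_density: "\<tau> > 0 \<Longrightarrow> (\<integral>\<^sup>+x. ennreal (gauss_density \<tau> x) \<partial>lborel) = 1"
  using nn_integral_gauss_density_exp[of \<tau> 0] by simp

lemma bind_poisson_sample_gaussian:
  fixes \<mu> :: "'x set \<Rightarrow> real ^ 'm::finite" and q :: real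
  assumes D: "finite D" and \<tau>: "\<tau> > 0"
  defines "p \<equiv> \<lambda>v. \<Sum>J\<in>Pow D. pmf (poisson_sample q D) J * gauss_density \<tau> (v - \<mu> J)"
  shows "measure_pmf (poisson_sample q D) \<bind> (\<lambda>J. distr (gaussian_noise \<tau>) borel (\<lambda>n. \<mu> J + n))
       = density lborel (\<lambda>v. ennreal (p v))" (is "?B = _")
    and "(\<integral>\<^sup>+v. ennreal (p v) \<partial>lborel) = 1"
proof -
  let ?w = "\<lambda>J. pmf (poisson_sample q D) J"
  have \<phi>: "gauss_density \<tau> v \<ge> 0" for v :: "real ^ 'm"
    using gauss_density_pos[OF \<tau>, of v] by simp
  have [measurable]: "p \<in> borel_measurable borel" unfolding p_def by measurable
  have K: "distr (gaussian_noise \<tau>) borel (\<lambda>n. \<mu> J + n)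
      = density lborel (\<lambda>v. ennreal (gauss_density \<tau> (v - \<mu> J)))" for J
  proof (rule measure_eqI)
    fix A assume "A \<in> sets (distr (gaussian_noise \<tau>) borel (\<lambda>n. \<mu> J + n))"
    then have [measurable]: "A \<in> sets borel" by simp
    have "emeasure (distr (gaussian_noise \<tau>) borel (\<lambda>n. \<mu> J + n)) A
        = (\<integral>\<^sup>+n. indicator A (\<mu> J + n) \<partial>gaussian_noise \<tau>)"
      by (simp add: gaussian_noise_altdef nn_integral_distr flip: nn_integral_indicator)
    also have "\<dots> = (\<integral>\<^sup>+n. ennreal (gauss_density \<tau> n) * indicator A (\<mu> J + n) \<partial>lborel)"
      unfolding gaussian_noise_altdef by (rule nn_integral_density) measurable
    also have "\<dots> = (\<integral>\<^sup>+v. ennreal (gauss_density \<tau> (v - \<mu> J)) * indicator A v \<partial>lborel)"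
      by (subst nn_integral_lborel_translate[of _ "\<mu> J", symmetric]) auto
    finally show "emeasure (distr (gaussian_noise \<tau>) borel (\<lambda>n. \<mu> J + n)) A
        = emeasure (density lborel (\<lambda>v. ennreal (gauss_density \<tau> (v - \<mu> J)))) A"
      by (simp add: emeasure_density)
  qed simp
  have total: "(\<integral>\<^sup>+v. ennreal (gauss_density \<tau> (v - c)) \<partial>lborel) = 1" for c :: "real ^ 'm"
    using nn_integral_lborel_translate[of "\<lambda>v. ennreal (gauss_density \<tau> v)" c]
    by (simp add: nn_integral_gauss_density[OF \<tau>])
  have prob: "prob_space (density lborel (\<lambda>v. ennreal (gauss_density \<tau> (v - c))))" for c :: "real ^ 'm"
    by (rule prob_spaceI) (simp add: emeasure_density total)
  have kernel: "(\<lambda>J. distr (gaussian_noise \<tau>) borel (\<lambda>n. \<mu> J + n))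
      \<in> measure_pmf (poisson_sample q D) \<rightarrow>\<^sub>M subprob_algebra borel"
    unfolding K measurable_pmf_measure1
    by (auto simp: space_subprob_algebra intro!: prob_space_imp_subprob_space prob)
  have sum: "(\<Sum>J\<in>Pow D. ennreal (gauss_density \<tau> (v - \<mu> J)) * ennreal (?w J)) = ennreal (p v)" for v
    unfolding p_def using \<phi>
    by (subst sum_ennreal[symmetric]) (auto simp: ennreal_mult' mult.commute)
  show "?B = density lborel (\<lambda>v. ennreal (p v))"
  proof (rule measure_eqI)
    have sets: "sets ?B = sets borel"
      by (rule sets_bind[OF sets_kernel[OF kernel]]) auto
    then show "sets ?B = sets (density lborel (\<lambda>v. ennreal (p v)))" by simp
    fix A assume "A \<in> sets ?B"
    then have A [measurable]: "A \<in> sets borel" by (simp add: sets)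
    have "emeasure ?B A = (\<integral>\<^sup>+J. emeasure (density lborel (\<lambda>v. ennreal (gauss_density \<tau> (v - \<mu> J)))) A
        \<partial>measure_pmf (poisson_sample q D))"
      by (subst emeasure_bind[OF _ kernel A]) (simp_all add: K)
    also have "\<dots> = (\<Sum>J\<in>Pow D. (\<integral>\<^sup>+v. ennreal (gauss_density \<tau> (v - \<mu> J)) * indicator A v \<partial>lborel) * ennreal (?w J))"
      using D set_pmf_poisson_sample[OF D, of q]
      by (subst nn_integral_measure_pmf_support[of "Pow D"]) (auto simp: emeasure_density)
    also have "\<dots> = (\<integral>\<^sup>+v. (\<Sum>J\<in>Pow D. ennreal (gauss_density \<tau> (v - \<mu> J)) * indicator A v * ennreal (?w J)) \<partial>lborel)"
      by (simp add: nn_integral_sum nn_integral_multc)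
    also have "\<dots> = (\<integral>\<^sup>+v. ennreal (p v) * indicator A v \<partial>lborel)"
      unfolding sum[symmetric] sum_distrib_right by (simp only: mult_ac)
    finally show "emeasure ?B A = emeasure (density lborel (\<lambda>v. ennreal (p v))) A"
      by (simp add: emeasure_density)
  qed
  have "(\<integral>\<^sup>+v. ennreal (p v) \<partial>lborel) = (\<Sum>J\<in>Pow D. ennreal (?w J))"
    unfolding sum[symmetric] by (simp add: nn_integral_sum nn_integral_multc total)
  then show "(\<integral>\<^sup>+v. ennreal (p v) \<partial>lborel) = 1"
    using sum_pmf_poisson_sample[OF D, of q] by (simp add: sum_ennreal)
qed

subsection \<open>Adaptive composition of densities\<close>

text \<open>\<open>N\<close> and \<open>N'\<close> only share their measurable sets, so that
  \<open>lborel\<close> can be the reference measure of a kernel into \<open>borel\<close>.\<close>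

lemma measurable_density_kernel:
  assumes N: "sigma_finite_measure N" and sets: "sets N = sets N'"
    and f: "(\<lambda>(x, y). f x y) \<in> borel_measurable (L \<Otimes>\<^sub>M N)"
    and total: "\<And>x. x \<in> space L \<Longrightarrow> (\<integral>\<^sup>+y. f x y \<partial>N) = 1"
  shows "(\<lambda>x. density N (f x)) \<in> L \<rightarrow>\<^sub>M subprob_algebra N'"
proof (rule measurable_subprob_algebra)
  have f' [measurable]: "f x \<in> borel_measurable N" if "x \<in> space L" for x
    using measurable_compose[OF measurable_Pair1'[OF that] f] by simp
  show "subprob_space (density N (f x))" if x: "x \<in> space L" for x
  proof -
    have "prob_space (density N (f x))"
      using x f'[OF x] total[OF x]
      by (intro prob_spaceI) (simp add: emeasure_density cong: nn_integral_cong)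
    then show ?thesis by (rule prob_space_imp_subprob_space)
  qed
  fix A assume "A \<in> sets N'"
  then have A [measurable]: "A \<in> sets N" by (simp add: sets)
  have "(\<lambda>x. \<integral>\<^sup>+y. f x y * indicator A y \<partial>N) \<in> borel_measurable L"
    using f by (intro sigma_finite_measure.borel_measurable_nn_integral[OF N])
      (simp add: split_beta')
  moreover have "emeasure (density N (f x)) A = (\<integral>\<^sup>+y. f x y * indicator A y \<partial>N)" if "x \<in> space L" for x
    using f'[OF that] by (simp add: emeasure_density)
  ultimately show "(\<lambda>x. emeasure (density N (f x)) A) \<in> borel_measurable L"
    by (simp cong: measurable_cong)
qed (simp add: sets)

lemma nn_integral_PiM_lborel_Suc:
  fixes F :: "(nat \<Rightarrow> 'v::euclidean_space) \<Rightarrow> ennreal"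
  assumes "F \<in> borel_measurable (PiM {..<Suc i} (\<lambda>_. lborel))"
  shows "(\<integral>\<^sup>+u. F u \<partial>PiM {..<Suc i} (\<lambda>_. lborel))
       = (\<integral>\<^sup>+u. (\<integral>\<^sup>+v. F (u(i := v)) \<partial>lborel) \<partial>PiM {..<i} (\<lambda>_. lborel))"
proof -
  interpret product_sigma_finite "\<lambda>_::nat. lborel :: 'v measure" by standard
  show ?thesis
    using product_nn_integral_insert[of "{..<i}" i F] assms by (simp add: lessThan_Suc)
qed

lemma sets_PiM_lborel: "sets (PiM I (\<lambda>_. lborel)) = sets (PiM I (\<lambda>_. borel))"
  by (intro sets_PiM_cong) auto

text \<open>Where p exceeds e^\<epsilon> q, the factor (p / (e^\<epsilon> q))^m is at least 1, so p
  \<le> e^(-\<epsilon> m) p^(m+1) / q^m; elsewhere p \<le> e^\<epsilon> q. The sum of both bounds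
  holds everywhere and is integrated over \<open>S\<close>. The gain is e^(-\<epsilon> m) with m one
  less than the order, because the ratio is weighted by p.\<close>

lemma measure_density_le_of_moment:
  fixes p q :: "'a \<Rightarrow> real" and \<delta> \<epsilon> :: real
  assumes [measurable]: "p \<in> borel_measurable N" "q \<in> borel_measurable N" "S \<in> sets N"
    and p: "\<And>x. x \<in> space N \<Longrightarrow> p x \<ge> 0" and q: "\<And>x. x \<in> space N \<Longrightarrow> q x > 0"
    and total: "(\<integral>\<^sup>+x. ennreal (q x) \<partial>N) = 1"
    and moment: "(\<integral>\<^sup>+x. ennreal (p x ^ Suc m / q x ^ m) \<partial>N) \<le> ennreal (\<delta> * exp (\<epsilon> * real m))"
    and \<delta>: "\<delta> \<ge> 0"
  shows "measure (density N (\<lambda>x. ennreal (p x))) S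
      \<le> exp \<epsilon> * measure (density N (\<lambda>x. ennreal (q x))) S + \<delta>"
proof -
  let ?P = "density N (\<lambda>x. ennreal (p x))" and ?Q = "density N (\<lambda>x. ennreal (q x))"
  define c where "c = exp (- (\<epsilon> * real m))"
  have c: "c \<ge> 0" by (simp add: c_def)
  have pointwise: "p x \<le> exp \<epsilon> * q x + c * (p x ^ Suc m / q x ^ m)" if x: "x \<in> space N" for x
  proof (cases "p x \<le> exp \<epsilon> * q x")
    case True
    moreover have "0 \<le> c * (p x ^ Suc m / q x ^ m)"
      using p[OF x] q[OF x] by (simp add: c_def)
    ultimately show ?thesis by linarith
  next
    case False
    then have "(exp \<epsilon> * q x) ^ m \<le> p x ^ m"
      using q[OF x] by (intro power_mono) auto
    then have "(exp \<epsilon> * q x) ^ m * p x \<le> p x ^ m * p x"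
      using p[OF x] by (rule mult_right_mono)
    then have "p x \<le> p x ^ m * p x / (exp \<epsilon> * q x) ^ m"
      using q[OF x] by (simp add: pos_le_divide_eq mult.commute)
    also have "\<dots> = c * (p x ^ Suc m / q x ^ m)"
      by (simp add: c_def exp_minus power_mult_distrib divide_inverse mult.commute
          flip: exp_of_nat_mult)
    moreover have "0 \<le> exp \<epsilon> * q x" using q[OF x] by simp
    ultimately show ?thesis by linarith
  qed
  have "emeasure ?P S = (\<integral>\<^sup>+x. ennreal (p x) * indicator S x \<partial>N)"
    by (simp add: emeasure_density)
  also have "\<dots> \<le> (\<integral>\<^sup>+x. ennreal (exp \<epsilon>) * (ennreal (q x) * indicator S x)
      + ennreal c * ennreal (p x ^ Suc m / q x ^ m) \<partial>N)"
  proof (rule nn_integral_mono)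
    fix x assume x: "x \<in> space N"
    have "ennreal (p x) \<le> ennreal (exp \<epsilon> * q x + c * (p x ^ Suc m / q x ^ m))"
      using pointwise[OF x] by (rule ennreal_leI)
    also have "\<dots> = ennreal (exp \<epsilon>) * ennreal (q x) + ennreal c * ennreal (p x ^ Suc m / q x ^ m)"
      using p[OF x] q[OF x] c
      by (simp add: ennreal_mult' del: power_Suc times_divide_eq_right)
    finally show "ennreal (p x) * indicator S x \<le> ennreal (exp \<epsilon>) * (ennreal (q x) * indicator S x)
      + ennreal c * ennreal (p x ^ Suc m / q x ^ m)"
      by (auto simp: indicator_def)
  qed
  also have "\<dots> = ennreal (exp \<epsilon>) * emeasure ?Q S
      + ennreal c * (\<integral>\<^sup>+x. ennreal (p x ^ Suc m / q x ^ m) \<partial>N)"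
    by (simp add: nn_integral_add nn_integral_cmult emeasure_density)
  also have "\<dots> \<le> ennreal (exp \<epsilon>) * emeasure ?Q S + ennreal c * ennreal (\<delta> * exp (\<epsilon> * real m))"
    by (intro add_left_mono mult_left_mono moment) auto
  also have "ennreal c * ennreal (\<delta> * exp (\<epsilon> * real m)) = ennreal \<delta>"
  proof -
    have "c * (\<delta> * exp (\<epsilon> * real m)) = \<delta>" by (simp add: c_def exp_minus field_simps)
    then show ?thesis by (simp only: ennreal_mult'[OF c, symmetric])
  qed
  also have "emeasure ?Q S = ennreal (measure ?Q S)"
  proof -
    have "prob_space ?Q"
      using total by (intro prob_spaceI) (simp add: emeasure_density cong: nn_integral_cong)
    then interpret prob_space ?Q .
    show ?thesis by (rule emeasure_eq_measure)
  qed
  finally have "emeasure ?P S \<le> ennreal (exp \<epsilon> * measure ?Q S + \<delta>)"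
    using \<delta> by (simp add: ennreal_mult')
  then show ?thesis
    using \<delta> unfolding measure_def[of ?P] by (intro enn2real_leI) auto
qed

text \<open>\<open>R i \<omega> u\<close> is the density of the next output given the seed and the
  previous outputs. Strict positivity allows moments to be written as plain quotients of
  densities.\<close>

locale density_chain =
  fixes M :: "'s measure" and T :: nat
    and R :: "nat \<Rightarrow> 's \<Rightarrow> (nat \<Rightarrow> real ^ 'm::finite) \<Rightarrow> real ^ 'm \<Rightarrow> real"
  assumes R_measurable:
      "\<And>i. i < T \<Longrightarrow> (\<lambda>((\<omega>, u), v). R i \<omega> u v) \<in> borel_measurable ((M \<Otimes>\<^sub>M output_space i) \<Otimes>\<^sub>M borel)"
    and R_pos: "\<And>i \<omega> u v. i < T \<Longrightarrow> R i \<omega> u v > 0"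
    and R_total: "\<And>i \<omega> u. i < T \<Longrightarrow> (\<integral>\<^sup>+v. ennreal (R i \<omega> u v) \<partial>lborel) = 1"
begin

text \<open>The restriction cuts the history down to a point of \<open>output_space j\<close>, the
  space on which \<open>R j\<close> is assumed measurable.\<close>

definition joint_density :: "nat \<Rightarrow> 's \<Rightarrow> (nat \<Rightarrow> real ^ 'm) \<Rightarrow> real" where
  "joint_density i \<omega> u = (\<Prod>j<i. R j \<omega> (restrict u {..<j}) (u j))"

lemma joint_density_pos: "i \<le> T \<Longrightarrow> joint_density i \<omega> u > 0"
  unfolding joint_density_def by (intro prod_pos) (auto intro: R_pos)

lemma joint_density_fun_upd:
  assumes "u \<in> space (PiM {..<i} N)"
  shows "joint_density (Suc i) \<omega> (u(i := v)) = joint_density i \<omega> u * R i \<omega> u v"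
proof -
  have "restrict (u(i := v)) {..<j} = restrict u {..<j}" if "j \<le> i" for j
    using that by (auto simp: restrict_def)
  moreover have "restrict u {..<i} = u"
    using assms by (auto simp: space_PiM intro: PiE_restrict)
  ultimately show ?thesis
    by (simp add: joint_density_def)
qed

lemma joint_density_measurable:
  assumes "i \<le> T"
  shows "(\<lambda>(\<omega>, u). joint_density i \<omega> u) \<in> borel_measurable (M \<Otimes>\<^sub>M output_space i)"
  unfolding joint_density_def split_beta'
proof (rule borel_measurable_prod)
  fix j assume j: "j \<in> {..<i}"
  have "(\<lambda>x. ((fst x, restrict (snd x) {..<j}), snd x j))
      \<in> M \<Otimes>\<^sub>M output_space i \<rightarrow>\<^sub>M (M \<Otimes>\<^sub>M output_space j) \<Otimes>\<^sub>M (borel :: (real ^ 'm) measure)"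
    using j by (intro measurable_Pair measurable_fst measurable_compose[OF measurable_snd]
        measurable_restrict_subset measurable_component_singleton) auto
  from measurable_compose[OF this R_measurable] j assms
  show "(\<lambda>x. R j (fst x) (restrict (snd x) {..<j}) (snd x j)) \<in> borel_measurable (M \<Otimes>\<^sub>M output_space i)"
    by simp
qed

context
  fixes \<omega> assumes \<omega>: "\<omega> \<in> space M"
begin

lemma R_section_measurable:
  assumes "i < T"
  shows "(\<lambda>(u, v). R i \<omega> u v) \<in> borel_measurable (output_space i \<Otimes>\<^sub>M borel)"
proof -
  have "(\<lambda>x. ((\<omega>, fst x), snd x))
      \<in> output_space i \<Otimes>\<^sub>M (borel :: (real ^ 'm) measure) \<rightarrow>\<^sub>M (M \<Otimes>\<^sub>M output_space i) \<Otimes>\<^sub>M borel"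
    using \<omega> by measurable
  from measurable_compose[OF this R_measurable[OF assms]] show ?thesis
    by (simp add: split_beta')
qed

lemma joint_density_section_measurable:
  assumes "i \<le> T"
  shows "joint_density i \<omega> \<in> borel_measurable (output_space i)"
  using measurable_compose[OF measurable_Pair1'[OF \<omega>] joint_density_measurable[OF assms]] by simp

lemma R_measurable_snd:
  assumes "i < T" "u \<in> space (PiM {..<i} (\<lambda>_. lborel))"
  shows "R i \<omega> u \<in> borel_measurable borel"
proof -
  have "u \<in> space (output_space i)" using assms(2) by (simp add: space_PiM)
  from measurable_compose[OF measurable_Pair1'[OF this] R_section_measurable[OF assms(1)]]
  show ?thesis by simp
qed

lemma nn_integral_joint_density:
  "i \<le> T \<Longrightarrow> (\<integral>\<^sup>+u. ennreal (joint_density i \<omega> u) \<partial>PiM {..<i} (\<lambda>_. lborel)) = 1"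
proof (induction i)
  case 0
  have "prob_space (PiM {} (\<lambda>_::nat. lborel :: (real ^ 'm) measure))"
    by (simp add: PiM_empty prob_spaceI)
  then show ?case
    by (simp add: joint_density_def prob_space.emeasure_space_1)
next
  case (Suc i)
  have "(\<integral>\<^sup>+u. ennreal (joint_density (Suc i) \<omega> u) \<partial>PiM {..<Suc i} (\<lambda>_. lborel))
      = (\<integral>\<^sup>+u. (\<integral>\<^sup>+v. ennreal (joint_density (Suc i) \<omega> (u(i := v))) \<partial>lborel) \<partial>PiM {..<i} (\<lambda>_. lborel))"
    using joint_density_section_measurable[OF Suc.prems] by (intro nn_integral_PiM_lborel_Suc) measurable
  also have "\<dots> = (\<integral>\<^sup>+u. ennreal (joint_density i \<omega> u) \<partial>PiM {..<i} (\<lambda>_. lborel))"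
  proof (rule nn_integral_cong)
    fix u assume u: "u \<in> space (PiM {..<i} (\<lambda>_. lborel :: (real ^ 'm) measure))"
    have [measurable]: "R i \<omega> u \<in> borel_measurable borel"
      using Suc.prems u by (intro R_measurable_snd) auto
    show "(\<integral>\<^sup>+v. ennreal (joint_density (Suc i) \<omega> (u(i := v))) \<partial>lborel) = ennreal (joint_density i \<omega> u)"
      using Suc.prems joint_density_pos[of i \<omega> u, THEN less_imp_le]
      by (simp add: joint_density_fun_upd[OF u] ennreal_mult' nn_integral_cmult R_total)
  qed
  finally show ?case using Suc by simp
qed

text \<open>A nested chain of \<open>bind\<close>s offers no density ratio to work with; this turns
  it into one density with respect to a product of Lebesgue measures. \<open>P\<close> is any
  sequence obeying the recursion and is later instantiated with \<open>outputs_given\<close> at a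
  fixed seed.\<close>

lemma chain_eq_density:
  assumes P_0: "P 0 = return (output_space 0) (\<lambda>_. undefined)"
    and P_Suc: "\<And>i. i < T \<Longrightarrow> P (Suc i) = P i \<bind>
        (\<lambda>u. distr (density lborel (\<lambda>v. ennreal (R i \<omega> u v))) (output_space (Suc i)) (\<lambda>v. u(i := v)))"
  shows "i \<le> T \<Longrightarrow> P i = density (PiM {..<i} (\<lambda>_. lborel)) (\<lambda>u. ennreal (joint_density i \<omega> u))"
proof (induction i)
  case 0
  show ?case
    unfolding P_0
  \<comment> \<open>The empty product has a single point, so only the two trivial events have to be
    compared.\<close>
  proof (rule measure_eqI)
    fix A assume "A \<in> sets (return (output_space 0) (\<lambda>_. undefined :: real ^ 'm))"
    then have A: "A \<in> sets (PiM {} (\<lambda>_::nat. borel :: (real ^ 'm) measure))" by simp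
    have "density (PiM {..<0} (\<lambda>_. lborel :: (real ^ 'm) measure)) (\<lambda>u. ennreal (joint_density 0 \<omega> u))
        = PiM {} (\<lambda>_. lborel)"
      by (simp add: joint_density_def density_1)
    moreover from A have "A = {} \<or> A = {\<lambda>_. undefined}"
      by (simp add: sets_PiM_empty)
    then have "emeasure (return (output_space 0) (\<lambda>_. undefined)) A = emeasure (PiM {} (\<lambda>_. lborel)) A"
      using A by (elim disjE) (simp_all add: emeasure_return)
    ultimately show "emeasure (return (output_space 0) (\<lambda>_. undefined)) A
        = emeasure (density (PiM {..<0} (\<lambda>_. lborel)) (\<lambda>u. ennreal (joint_density 0 \<omega> u))) A"
      by (simp only:)
  qed (simp add: sets_PiM_empty)
next
  case (Suc i)
  let ?N = "\<lambda>i. PiM {..<i} (\<lambda>_. lborel :: (real ^ 'm) measure)"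
  let ?K = "\<lambda>u. distr (density lborel (\<lambda>v. ennreal (R i \<omega> u v))) (output_space (Suc i)) (\<lambda>v. u(i := v))"
  have i: "i < T" "i \<le> T" using Suc.prems by auto
  have P: "P (Suc i) = density (?N i) (\<lambda>u. ennreal (joint_density i \<omega> u)) \<bind> ?K"
    using Suc.IH P_Suc i by simp
  have upd: "(\<lambda>(u, v). u(i := v)) \<in> output_space i \<Otimes>\<^sub>M borel \<rightarrow>\<^sub>M output_space (Suc i)"
    unfolding split_beta' by (rule measurable_fun_upd[where J = "{..<i}"]) auto
  have K0: "?K \<in> output_space i \<rightarrow>\<^sub>M subprob_algebra (output_space (Suc i))"
  proof (rule measurable_distr2[OF upd])
    show "(\<lambda>u. density lborel (\<lambda>v. ennreal (R i \<omega> u v))) \<in> output_space i \<rightarrow>\<^sub>M subprob_algebra borel"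
    proof (rule measurable_density_kernel)
      show "(\<lambda>(u, v). ennreal (R i \<omega> u v)) \<in> borel_measurable (output_space i \<Otimes>\<^sub>M lborel)"
        using R_section_measurable[OF i(1)]
        by (simp add: split_beta' cong: measurable_cong_sets sets_pair_measure_cong)
    qed (auto simp: R_total i lborel.sigma_finite_measure_axioms)
  qed
  have K: "?K \<in> density (?N i) (\<lambda>u. ennreal (joint_density i \<omega> u)) \<rightarrow>\<^sub>M subprob_algebra (output_space (Suc i))"
    using K0 by (simp add: sets_PiM_lborel cong: measurable_cong_sets)
  have ne: "space (density (?N i) (\<lambda>u. ennreal (joint_density i \<omega> u))) \<noteq> {}"
    by (simp add: space_PiM PiE_eq_empty_iff)
  have sets: "sets (P (Suc i)) = sets (output_space (Suc i))"
    unfolding P by (rule sets_bind[OF sets_kernel[OF K] ne])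
  show ?case
  proof (rule measure_eqI)
    show "sets (P (Suc i)) = sets (density (?N (Suc i)) (\<lambda>u. ennreal (joint_density (Suc i) \<omega> u)))"
      by (simp add: sets sets_PiM_lborel)
    fix A assume "A \<in> sets (P (Suc i))"
    then have A: "A \<in> sets (output_space (Suc i))" by (simp add: sets)
    then have A' [measurable]: "A \<in> sets (?N (Suc i))" by (simp add: sets_PiM_lborel)
    note [measurable] = joint_density_section_measurable[OF i(2)] joint_density_section_measurable[OF Suc.prems]
    have "emeasure (P (Suc i)) A = (\<integral>\<^sup>+u. ennreal (joint_density i \<omega> u) * emeasure (?K u) A \<partial>?N i)"
    proof -
      have [measurable]: "(\<lambda>u. emeasure (?K u) A) \<in> borel_measurable (?N i)"
        using measurable_compose[OF K0 measurable_emeasure_subprob_algebra[OF A]]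
        by (simp add: sets_PiM_lborel cong: measurable_cong_sets)
      show ?thesis
        unfolding P emeasure_bind[OF ne K A] by (rule nn_integral_density) measurable
    qed
    also have "\<dots> = (\<integral>\<^sup>+u. (\<integral>\<^sup>+v. ennreal (joint_density (Suc i) \<omega> (u(i := v))) * indicator A (u(i := v)) \<partial>lborel) \<partial>?N i)"
    proof (rule nn_integral_cong)
      fix u assume u: "u \<in> space (?N i)"
      have [measurable]: "R i \<omega> u \<in> borel_measurable borel"
        by (rule R_measurable_snd[OF i(1) u])
      have u': "u \<in> space (output_space i)" using u by (simp add: space_PiM)
      have [measurable]: "(\<lambda>v. u(i := v)) \<in> borel \<rightarrow>\<^sub>M output_space (Suc i)"
        using measurable_compose[OF measurable_Pair1'[OF u'] upd] by simp
      note [measurable] = A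
      have "emeasure (?K u) A = (\<integral>\<^sup>+v. indicator A (u(i := v)) \<partial>density lborel (\<lambda>v. ennreal (R i \<omega> u v)))"
        by (simp add: nn_integral_distr flip: nn_integral_indicator)
      also have "\<dots> = (\<integral>\<^sup>+v. ennreal (R i \<omega> u v) * indicator A (u(i := v)) \<partial>lborel)"
        by (rule nn_integral_density) measurable
      finally show "ennreal (joint_density i \<omega> u) * emeasure (?K u) A
        = (\<integral>\<^sup>+v. ennreal (joint_density (Suc i) \<omega> (u(i := v))) * indicator A (u(i := v)) \<partial>lborel)"
        using joint_density_pos[OF i(2), of \<omega> u, THEN less_imp_le]
        by (simp add: joint_density_fun_upd[OF u] ennreal_mult' mult.assoc nn_integral_cmult)
    qed
    also have "\<dots> = (\<integral>\<^sup>+u. ennreal (joint_density (Suc i) \<omega> u) * indicator A u \<partial>?N (Suc i))"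
      by (rule nn_integral_PiM_lborel_Suc[symmetric]) measurable
    finally show "emeasure (P (Suc i)) A
        = emeasure (density (?N (Suc i)) (\<lambda>u. ennreal (joint_density (Suc i) \<omega> u))) A"
      by (simp add: emeasure_density)
  qed
qed

end

end

text \<open>The quotient of joint densities is a product over rounds. The bound for a round is
  uniform in the history \<open>u\<close>, so integrating the last output first splits off the
  constant \<open>B i\<close>, however adaptively that round was chosen.\<close>

lemma nn_integral_joint_density_moment_le:
  fixes R R' :: "nat \<Rightarrow> 's \<Rightarrow> (nat \<Rightarrow> real ^ 'm::finite) \<Rightarrow> real ^ 'm \<Rightarrow> real"
  assumes "density_chain M T R" "density_chain M T R'" and \<omega>: "\<omega> \<in> space M"
    and B: "\<And>i. B i \<ge> 0"
    and le: "\<And>i u. i < T \<Longrightarrow>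
      (\<integral>\<^sup>+v. ennreal (R i \<omega> u v ^ Suc m / R' i \<omega> u v ^ m) \<partial>lborel) \<le> ennreal (B i)"
  shows "i \<le> T \<Longrightarrow> (\<integral>\<^sup>+u. ennreal (density_chain.joint_density R i \<omega> u ^ Suc m
            / density_chain.joint_density R' i \<omega> u ^ m) \<partial>PiM {..<i} (\<lambda>_. lborel))
       \<le> ennreal (\<Prod>j<i. B j)"
proof (induction i)
  interpret R: density_chain M T R by fact
  interpret R': density_chain M T R' by fact
  {
    case 0
    show ?case
      by (simp add: R.joint_density_def R'.joint_density_def PiM_empty emeasure_count_space)
  next
    case (Suc i)
    let ?N = "\<lambda>i. PiM {..<i} (\<lambda>_. lborel :: (real ^ 'm) measure)"
    let ?F = "\<lambda>i u. R.joint_density i \<omega> u ^ Suc m / R'.joint_density i \<omega> u ^ m"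
    have i: "i < T" "i \<le> T" using Suc.prems by auto
    note [measurable] = R.joint_density_section_measurable[OF \<omega> Suc.prems]
      R'.joint_density_section_measurable[OF \<omega> Suc.prems]
      R.joint_density_section_measurable[OF \<omega> i(2)] R'.joint_density_section_measurable[OF \<omega> i(2)]
    have F: "?F i u \<ge> 0" for u
      using R.joint_density_pos[OF i(2)] R'.joint_density_pos[OF i(2)]
      by (intro divide_nonneg_pos) (auto intro!: zero_le_power less_imp_le zero_less_power
          simp del: power_Suc)
    have "(\<integral>\<^sup>+u. ennreal (?F (Suc i) u) \<partial>?N (Suc i))
        = (\<integral>\<^sup>+u. (\<integral>\<^sup>+v. ennreal (?F (Suc i) (u(i := v))) \<partial>lborel) \<partial>?N i)"
      by (intro nn_integral_PiM_lborel_Suc) measurable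
    also have "\<dots> \<le> (\<integral>\<^sup>+u. ennreal (?F i u) * ennreal (B i) \<partial>?N i)"
    proof (rule nn_integral_mono)
      fix u assume u: "u \<in> space (?N i)"
      have [measurable]: "R i \<omega> u \<in> borel_measurable borel" "R' i \<omega> u \<in> borel_measurable borel"
        using R.R_measurable_snd[OF \<omega> i(1) u] R'.R_measurable_snd[OF \<omega> i(1) u] .
      have "?F (Suc i) (u(i := v)) = ?F i u * (R i \<omega> u v ^ Suc m / R' i \<omega> u v ^ m)" for v
        unfolding R.joint_density_fun_upd[OF u] R'.joint_density_fun_upd[OF u]
        by (simp add: power_mult_distrib del: power_Suc)
      then have "(\<integral>\<^sup>+v. ennreal (?F (Suc i) (u(i := v))) \<partial>lborel)
          = (\<integral>\<^sup>+v. ennreal (?F i u) * ennreal (R i \<omega> u v ^ Suc m / R' i \<omega> u v ^ m) \<partial>lborel)"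
        by (simp only: ennreal_mult'[OF F])
      also have "\<dots> = ennreal (?F i u) * (\<integral>\<^sup>+v. ennreal (R i \<omega> u v ^ Suc m / R' i \<omega> u v ^ m) \<partial>lborel)"
        by (rule nn_integral_cmult) measurable
      also have "\<dots> \<le> ennreal (?F i u) * ennreal (B i)"
        by (intro mult_left_mono le i) auto
      finally show "(\<integral>\<^sup>+v. ennreal (?F (Suc i) (u(i := v))) \<partial>lborel) \<le> ennreal (?F i u) * ennreal (B i)" .
    qed
    also have "\<dots> = (\<integral>\<^sup>+u. ennreal (?F i u) \<partial>?N i) * ennreal (B i)"
      by (rule nn_integral_multc) measurable
    also have "\<dots> \<le> ennreal (\<Prod>j<i. B j) * ennreal (B i)"
      by (intro mult_right_mono Suc.IH i) auto
    also have "\<dots> = ennreal (\<Prod>j<Suc i. B j)"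
      using B by (simp add: prod_nonneg flip: ennreal_mult)
    finally show ?case .
  }
qed

lemma (in density_chain) joint_density_kernel:
  "(\<lambda>\<omega>. density (PiM {..<T} (\<lambda>_. lborel)) (\<lambda>u. ennreal (joint_density T \<omega> u)))
     \<in> M \<rightarrow>\<^sub>M subprob_algebra (output_space T)"
proof (rule measurable_density_kernel)
  interpret product_sigma_finite "\<lambda>_::nat. lborel :: (real ^ 'm) measure" by standard
  show "sigma_finite_measure (PiM {..<T} (\<lambda>_. lborel :: (real ^ 'm) measure))"
    by (rule sigma_finite) simp
  show sets: "sets (PiM {..<T} (\<lambda>_. lborel)) = sets (output_space T)"
    by (rule sets_PiM_lborel)
  show "(\<lambda>(\<omega>, u). ennreal (joint_density T \<omega> u)) \<in> borel_measurable (M \<Otimes>\<^sub>M PiM {..<T} (\<lambda>_. lborel))"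
    using joint_density_measurable[of T]
    by (simp add: split_beta' cong: measurable_cong_sets sets_pair_measure_cong)
qed (simp add: nn_integral_joint_density)

text \<open>The privacy inequality is affine in the two probabilities, so it survives averaging over
  a seed whose distribution is the same for both data sets.\<close>

lemma measure_bind_le:
  fixes \<epsilon> \<delta> :: real
  assumes M: "prob_space M" and K: "K \<in> M \<rightarrow>\<^sub>M subprob_algebra L" and K': "K' \<in> M \<rightarrow>\<^sub>M subprob_algebra L"
    and S: "S \<in> sets L" and \<delta>: "\<delta> \<ge> 0"
    and le: "\<And>\<omega>. \<omega> \<in> space M \<Longrightarrow> measure (K \<omega>) S \<le> exp \<epsilon> * measure (K' \<omega>) S + \<delta>"
  shows "measure (M \<bind> K) S \<le> exp \<epsilon> * measure (M \<bind> K') S + \<delta>"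
proof -
  interpret prob_space M by fact
  have [measurable]: "(\<lambda>\<omega>. emeasure (K' \<omega>) S) \<in> borel_measurable M"
    using measurable_compose[OF K' measurable_emeasure_subprob_algebra[OF S]] .
  interpret B': subprob_space "M \<bind> K'"
    using prob_space_imp_subprob_space[OF M] K' by (rule subprob_space_bind)
  have eq: "emeasure (F \<omega>) S = ennreal (measure (F \<omega>) S)"
    if "F \<in> M \<rightarrow>\<^sub>M subprob_algebra L" "\<omega> \<in> space M" for F \<omega>
  proof -
    interpret subprob_space "F \<omega>" using subprob_space_kernel[OF that] .
    show ?thesis by (rule emeasure_eq_measure)
  qed
  have "emeasure (M \<bind> K) S = (\<integral>\<^sup>+\<omega>. emeasure (K \<omega>) S \<partial>M)"
    by (rule emeasure_bind[OF not_empty K S])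
  also have "\<dots> \<le> (\<integral>\<^sup>+\<omega>. ennreal (exp \<epsilon>) * emeasure (K' \<omega>) S + ennreal \<delta> \<partial>M)"
  proof (rule nn_integral_mono)
    fix \<omega> assume \<omega>: "\<omega> \<in> space M"
    have "ennreal (measure (K \<omega>) S) \<le> ennreal (exp \<epsilon> * measure (K' \<omega>) S + \<delta>)"
      using le[OF \<omega>] by (rule ennreal_leI)
    then show "emeasure (K \<omega>) S \<le> ennreal (exp \<epsilon>) * emeasure (K' \<omega>) S + ennreal \<delta>"
      using \<delta> by (simp add: eq[OF K \<omega>] eq[OF K' \<omega>] ennreal_mult')
  qed
  also have "\<dots> = ennreal (exp \<epsilon>) * emeasure (M \<bind> K') S + ennreal \<delta>"
    by (simp add: nn_integral_add nn_integral_cmult emeasure_bind[OF not_empty K' S] emeasure_space_1)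
  also have "\<dots> = ennreal (exp \<epsilon> * measure (M \<bind> K') S + \<delta>)"
    using \<delta> by (simp add: B'.emeasure_eq_measure ennreal_mult')
  finally show ?thesis
    using \<delta> unfolding measure_def[of "M \<bind> K"] by (intro enn2real_leI) auto
qed

subsection \<open>DP-SGD\<close>

lemma current_model_measurable:
  assumes rec: "\<And>k. (\<lambda>(\<omega>, u). received srv i \<omega> u k) \<in> M \<rightarrow>\<^sub>M borel"
    and w: "(\<lambda>(\<omega>, u). w \<omega> u) \<in> M \<rightarrow>\<^sub>M borel"
    and k: "(\<lambda>(\<omega>, u). k \<omega> u) \<in> M \<rightarrow>\<^sub>M count_space UNIV"
  shows "(\<lambda>(\<omega>, u). current_model srv i \<omega> u (w \<omega> u) (k \<omega> u)) \<in> M \<rightarrow>\<^sub>M borel"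
proof -
  have "(\<lambda>x. current_model srv i (fst x) (snd x) (w (fst x) (snd x)) n) \<in> M \<rightarrow>\<^sub>M borel" for n
    using rec[of "n - 1"] w by (cases "n = 0") (simp_all add: current_model_def split_beta')
  \<comment> \<open>The number of models received so far is random, but it takes only countably many
    values.\<close>
  from measurable_compose_countable[OF this k[unfolded split_beta']]
  show ?thesis by (simp add: split_beta')
qed

lemma start_model_measurable:
  fixes srv :: "('s, 'x, 'c::finite) server"
  assumes srv: "valid_server T srv"
  shows "i \<le> T \<Longrightarrow> (\<lambda>(\<omega>, u). start_model srv \<eta> i \<omega> u) \<in> seed srv \<Otimes>\<^sub>M output_space i \<rightarrow>\<^sub>M borel"
proof (induction i)
  case (Suc i)
  have i: "i < T" using Suc.prems by simp
  define F where "F = (\<lambda>(\<omega>, u). current_model srv i \<omega> u (start_model srv \<eta> i \<omega> u) (num_received srv i \<omega> u))"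
  have F: "F \<in> seed srv \<Otimes>\<^sub>M output_space i \<rightarrow>\<^sub>M borel"
    unfolding F_def using srv i Suc by (intro current_model_measurable) (auto simp: valid_server_def)
  have r: "(\<lambda>x. (fst x, restrict (snd x) {..<i}))
      \<in> seed srv \<Otimes>\<^sub>M output_space (Suc i) \<rightarrow>\<^sub>M seed srv \<Otimes>\<^sub>M output_space i"
    by (intro measurable_Pair measurable_fst measurable_compose[OF measurable_snd]
        measurable_restrict_subset) auto
  have "(\<lambda>x. snd x i) \<in> seed srv \<Otimes>\<^sub>M output_space (Suc i) \<rightarrow>\<^sub>M (borel :: (real ^ 'c) measure)"
    by (rule measurable_compose[OF measurable_snd measurable_component_singleton]) simp
  from borel_measurable_add[OF measurable_compose[OF r F] borel_measurable_scaleR[OF measurable_const this]]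
  show ?case
    by (simp add: split_beta' Let_def F_def)
qed (simp add: split_beta')

context dpsgd_parameters
begin

section \<open>Densities of a round and of the whole run\<close>

definition mean_output :: "'x set \<Rightarrow> nat \<Rightarrow> 's \<Rightarrow> (nat \<Rightarrow> real ^ 'm) \<Rightarrow> real ^ 'm" where
  "mean_output J i \<omega> u = (\<Sum>\<xi>\<in>J. clip C (loss_gradient f (model_at srv \<eta> i \<omega> u \<xi>) \<xi>))"

definition round_density :: "'x set \<Rightarrow> nat \<Rightarrow> 's \<Rightarrow> (nat \<Rightarrow> real ^ 'm) \<Rightarrow> real ^ 'm \<Rightarrow> real" where
  "round_density d i \<omega> u v = (\<Sum>J\<in>Pow d. pmf (poisson_sample (real (s i) / real N) d) J
       * gauss_density (C * noise i) (v - mean_output J i \<omega> u))"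

lemma round_output_eq_density:
  assumes "finite d" "C * noise i > 0"
  shows "round_output d i \<omega> u = density lborel (\<lambda>v. ennreal (round_density d i \<omega> u v))"
  unfolding round_output_def round_density_def mean_output_def
  using assms by (rule bind_poisson_sample_gaussian)

lemma mean_output_measurable:
  assumes srv: "valid_server T srv" and diff: "\<And>w \<xi>. (\<lambda>v. f v \<xi>) differentiable (at w)" and i: "i < T"
  shows "(\<lambda>(\<omega>, u). mean_output J i \<omega> u) \<in> borel_measurable (seed srv \<Otimes>\<^sub>M output_space i)"
proof -
  have grad: "(\<lambda>w. clip C (loss_gradient f w \<xi>)) \<in> borel_measurable borel" for \<xi>
    using measurable_compose[OF the_gderiv_measurable[OF diff] clip_measurable]
    by (simp add: loss_gradient_def)
  have "(\<lambda>(\<omega>, u). model_at srv \<eta> i \<omega> u \<xi>) \<in> seed srv \<Otimes>\<^sub>M output_space i \<rightarrow>\<^sub>M borel" for \<xi>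
    unfolding model_at_def using srv i start_model_measurable[OF srv, of i \<eta>]
    by (intro current_model_measurable) (auto simp: valid_server_def)
  from measurable_compose[OF this grad]
  show ?thesis
    by (simp add: mean_output_def split_beta')
qed

lemma density_chain_round_density:
  assumes srv: "valid_server T srv" and diff: "\<And>w \<xi>. (\<lambda>v. f v \<xi>) differentiable (at w)"
    and d: "finite d" and noise: "\<And>i. C * noise i > 0"
  shows "density_chain (seed srv) T (round_density d)"
proof
  fix i assume i: "i < T"
  have [measurable]: "(\<lambda>x. mean_output J i (fst (fst x)) (snd (fst x)))
      \<in> borel_measurable ((seed srv \<Otimes>\<^sub>M output_space i) \<Otimes>\<^sub>M (borel :: (real ^ 'm) measure))" for J
    using measurable_compose[OF measurable_fst mean_output_measurable[OF srv diff i, of J]]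
    by (simp add: split_beta')
  show "(\<lambda>((\<omega>, u), v). round_density d i \<omega> u v)
      \<in> borel_measurable ((seed srv \<Otimes>\<^sub>M output_space i) \<Otimes>\<^sub>M borel)"
    unfolding round_density_def split_beta' by measurable
next
  fix i \<omega> u and v :: "real ^ 'm"
  let ?q = "real (s i) / real N"
  have "(\<Sum>J\<in>Pow d. pmf (poisson_sample ?q d) J) \<noteq> 0"
    using sum_pmf_poisson_sample[OF d, of ?q] by simp
  then obtain J where "J \<in> Pow d" "pmf (poisson_sample ?q d) J > 0"
    by (metis less_eq_real_def pmf_nonneg sum.neutral)
  then show "round_density d i \<omega> u v > 0"
    unfolding round_density_def using d
    by (intro sum_pos2[of "Pow d" J])
      (auto intro!: mult_pos_pos mult_nonneg_nonneg gauss_density_pos less_imp_le[OF gauss_density_pos] noise)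
next
  fix i \<omega> u
  show "(\<integral>\<^sup>+v. ennreal (round_density d i \<omega> u v) \<partial>lborel) = 1"
    unfolding round_density_def using d noise by (rule bind_poisson_sample_gaussian)
qed

lemma outputs_given_eq_density:
  assumes srv: "valid_server T srv" and diff: "\<And>w \<xi>. (\<lambda>v. f v \<xi>) differentiable (at w)"
    and d: "finite d" and noise: "\<And>i. C * noise i > 0" and \<omega>: "\<omega> \<in> space (seed srv)"
  shows "outputs_given d T \<omega> = density (PiM {..<T} (\<lambda>_. lborel))
           (\<lambda>u. ennreal (density_chain.joint_density (round_density d) T \<omega> u))"
proof -
  interpret density_chain "seed srv" T "round_density d"
    using srv diff d noise by (rule density_chain_round_density)
  show ?thesis
    using chain_eq_density[OF \<omega>, of "\<lambda>i. outputs_given d i \<omega>" T]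
    by (simp add: round_output_eq_density[OF d noise])
qed

lemma outputs_given_kernel:
  assumes srv: "valid_server T srv" and diff: "\<And>w \<xi>. (\<lambda>v. f v \<xi>) differentiable (at w)"
    and d: "finite d" and noise: "\<And>i. C * noise i > 0"
  shows "outputs_given d T \<in> seed srv \<rightarrow>\<^sub>M subprob_algebra (output_space T)"
proof -
  interpret density_chain "seed srv" T "round_density d"
    using srv diff d noise by (rule density_chain_round_density)
  show ?thesis
    using joint_density_kernel outputs_given_eq_density[OF srv diff d noise]
    by (simp cong: measurable_cong)
qed

text \<open>The model in use at \<open>x\<close> is a function of the seed and the previous outputs,
  so including \<open>x\<close> shifts the mean by the same vector g for every sample J of the other
  records. Clipping gives |g|^2 / \<tau>^2 \<le> 1 / \<sigma>^2 \<le> 1 / v, as required by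
  \<open>subsampled_moment_le\<close>.\<close>

lemma round_density_moment_le:
  fixes \<sigma> v :: real and m :: nat and \<omega> :: 's and u :: "nat \<Rightarrow> real ^ 'm"
  assumes C: "C > 0" and \<sigma>: "\<sigma> > 0" "v \<le> \<sigma>\<^sup>2" "noise i = \<sigma>" and v: "v \<ge> 2"
    and m: "v \<le> real (Suc m)" "real (Suc m) \<le> v + 1"
    and D: "finite D" "x \<notin> D"
    and q: "s i \<le> N" "real (s i) / real N \<le> 1 / (exp 1 * sqrt v)"
  defines "B \<equiv> 1 + (real (s i) / real N)\<^sup>2 * (2 * real (Suc m) - v)"
  shows "(\<integral>\<^sup>+y. ennreal (round_density (insert x D) i \<omega> u y ^ Suc m / round_density D i \<omega> u y ^ m) \<partial>lborel)
           \<le> ennreal B"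
    and "(\<integral>\<^sup>+y. ennreal (round_density D i \<omega> u y ^ Suc m / round_density (insert x D) i \<omega> u y ^ m) \<partial>lborel)
           \<le> ennreal B"
proof -
  define q where "q = real (s i) / real N"
  define \<tau> where "\<tau> = C * \<sigma>"
  define g where "g = clip C (loss_gradient f (model_at srv \<eta> i \<omega> u x) x)"
  have \<tau>: "\<tau> > 0" using C \<sigma> by (simp add: \<tau>_def)
  have q01: "0 \<le> q" "q \<le> 1" using q(1) by (auto simp: q_def divide_le_eq)
  have "(norm g)\<^sup>2 \<le> C\<^sup>2"
    unfolding g_def using C by (intro power_mono norm_clip_le) auto
  then have "(norm g)\<^sup>2 / \<tau>\<^sup>2 \<le> C\<^sup>2 / \<tau>\<^sup>2" by (intro divide_right_mono) auto
  also have "\<dots> = 1 / \<sigma>\<^sup>2" using C by (simp add: \<tau>_def power_mult_distrib)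
  also have "\<dots> \<le> 1 / v" using \<sigma> v by (intro divide_left_mono) auto
  finally have u: "(norm g)\<^sup>2 / \<tau>\<^sup>2 \<le> 1 / v" .
  have "subsampled_moment q (Suc m) ((norm g)\<^sup>2 / \<tau>\<^sup>2) \<le> B"
    unfolding B_def q_def[symmetric] using q01 v u m q(2)[folded q_def] by (rule subsampled_moment_le)
  then have B: "ennreal (subsampled_moment q (Suc m) ((norm g)\<^sup>2 / \<tau>\<^sup>2)) \<le> ennreal B"
    by (rule ennreal_leI)
  have mean: "y - mean_output (insert x J) i \<omega> u = y - mean_output J i \<omega> u - g" if "J \<in> Pow D" for J y
  proof -
    have "finite J" "x \<notin> J" using that D by (auto intro: finite_subset)
    then show ?thesis by (simp add: mean_output_def g_def algebra_simps)
  qed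
  have small: "round_density D i \<omega> u y = (\<Sum>J\<in>Pow D. pmf (poisson_sample q D) J
      * gauss_density \<tau> (y - mean_output J i \<omega> u))" for y
    by (simp add: round_density_def q_def \<tau>_def \<sigma>)
  have large: "round_density (insert x D) i \<omega> u y = (\<Sum>J\<in>Pow D. pmf (poisson_sample q D) J
      * ((1 - q) * gauss_density \<tau> (y - mean_output J i \<omega> u)
          + q * gauss_density \<tau> (y - mean_output J i \<omega> u - g)))" for y
    unfolding round_density_def q_def[symmetric] \<sigma>(3) \<tau>_def[symmetric]
      sum_poisson_sample_insert[OF D q01] by (intro sum.cong refl) (simp add: mean)
  note renyi = gauss_mixture_renyi_le[OF \<tau> q01, where I = "Pow D" and w = "pmf (poisson_sample q D)"
      and \<mu> = "\<lambda>J. mean_output J i \<omega> u" and g = g and m = m, folded small large]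
  show "(\<integral>\<^sup>+y. ennreal (round_density (insert x D) i \<omega> u y ^ Suc m / round_density D i \<omega> u y ^ m) \<partial>lborel)
           \<le> ennreal B"
    using D sum_pmf_poisson_sample[OF D(1), of q] by (intro order_trans[OF renyi(1) B]) auto
  show "(\<integral>\<^sup>+y. ennreal (round_density D i \<omega> u y ^ Suc m / round_density (insert x D) i \<omega> u y ^ m) \<partial>lborel)
           \<le> ennreal B"
    using D sum_pmf_poisson_sample[OF D(1), of q] by (intro order_trans[OF renyi(2) B]) auto
qed

theorem dpsgd_differentially_private:
  fixes \<sigma> v \<epsilon> \<delta> :: real and m :: nat
  assumes C: "C > 0" and \<sigma>: "\<sigma> > 0" "v \<le> \<sigma>\<^sup>2" "\<And>i. noise i = \<sigma>" and v: "v \<ge> 2"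
    and m: "v \<le> real (Suc m)" "real (Suc m) \<le> v + 1"
    and q: "\<And>i. i < T \<Longrightarrow> s i \<le> N" "\<And>i. i < T \<Longrightarrow> real (s i) / real N \<le> 1 / (exp 1 * sqrt v)"
    and \<delta>: "\<delta> > 0"
    and budget: "(\<Sum>i<T. (real (s i) / real N)\<^sup>2) * (2 * real (Suc m) - v) \<le> ln \<delta> + \<epsilon> * real m"
    and srv: "valid_server T srv" and diff: "\<And>w \<xi>. (\<lambda>v. f v \<xi>) differentiable (at w)"
  shows "differentially_private N \<epsilon> \<delta> (output_space T) (dpsgd T)"
proof -
  have noise: "\<And>i. C * noise i > 0" using C \<sigma> by simp
  define B where "B = (\<lambda>i. 1 + (real (s i) / real N)\<^sup>2 * (2 * real (Suc m) - v))"
  have B: "B i \<ge> 0" for i using m v by (auto simp: B_def)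
  \<comment> \<open>The estimate 1 + t \<le> e^t turns the product over rounds into the sum
    controlled by \<open>budget\<close>.\<close>
  have "(\<Prod>i<T. B i) \<le> (\<Prod>i<T. exp ((real (s i) / real N)\<^sup>2 * (2 * real (Suc m) - v)))"
    using B by (intro prod_mono) (auto simp: B_def)
  also have "\<dots> = exp ((\<Sum>i<T. (real (s i) / real N)\<^sup>2) * (2 * real (Suc m) - v))"
    by (simp add: exp_sum sum_distrib_right)
  also have "\<dots> \<le> exp (ln \<delta> + \<epsilon> * real m)" using budget by simp
  also have "\<dots> = \<delta> * exp (\<epsilon> * real m)" using \<delta> by (simp add: exp_add)
  finally have prod_B: "(\<Prod>i<T. B i) \<le> \<delta> * exp (\<epsilon> * real m)" .
  \<comment> \<open>Adjacency enters only through the moment bound \<open>le\<close>. Since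
    \<open>B i\<close> is the same for adding and for removing a record, this claim serves both
    orders.\<close>
  have main: "measure (dpsgd T d) S \<le> exp \<epsilon> * measure (dpsgd T d') S + \<delta>"
    if d: "finite d" "finite d'" and S: "S \<in> sets (output_space T)"
      and le: "\<And>i \<omega> u. i < T \<Longrightarrow>
        (\<integral>\<^sup>+y. ennreal (round_density d i \<omega> u y ^ Suc m / round_density d' i \<omega> u y ^ m) \<partial>lborel) \<le> ennreal (B i)"
    for d d' :: "'x set" and S
    unfolding dpsgd_def
  proof (rule measure_bind_le)
    show "prob_space (seed srv)" using srv by (simp add: valid_server_def)
    fix \<omega> assume \<omega>: "\<omega> \<in> space (seed srv)"
    interpret P: density_chain "seed srv" T "round_density d"
      using srv diff d(1) noise by (rule density_chain_round_density)
    interpret Q: density_chain "seed srv" T "round_density d'"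
      using srv diff d(2) noise by (rule density_chain_round_density)
    show "measure (outputs_given d T \<omega>) S \<le> exp \<epsilon> * measure (outputs_given d' T \<omega>) S + \<delta>"
      unfolding outputs_given_eq_density[OF srv diff d(1) noise \<omega>]
        outputs_given_eq_density[OF srv diff d(2) noise \<omega>]
    proof (rule measure_density_le_of_moment)
      show "P.joint_density T \<omega> \<in> borel_measurable (PiM {..<T} (\<lambda>_. lborel))"
        "Q.joint_density T \<omega> \<in> borel_measurable (PiM {..<T} (\<lambda>_. lborel))"
        using P.joint_density_section_measurable[OF \<omega>] Q.joint_density_section_measurable[OF \<omega>]
        by (simp_all cong: measurable_cong_sets add: sets_PiM_lborel)
      show "S \<in> sets (PiM {..<T} (\<lambda>_. lborel))" using S by (simp add: sets_PiM_lborel)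
      show "(\<integral>\<^sup>+u. ennreal (P.joint_density T \<omega> u ^ Suc m / Q.joint_density T \<omega> u ^ m)
          \<partial>PiM {..<T} (\<lambda>_. lborel)) \<le> ennreal (\<delta> * exp (\<epsilon> * real m))"
        using nn_integral_joint_density_moment_le[OF P.density_chain_axioms Q.density_chain_axioms \<omega> B le order_refl]
          ennreal_leI[OF prod_B] by (rule order_trans)
    qed (use \<delta> P.joint_density_pos Q.joint_density_pos Q.nn_integral_joint_density[OF \<omega>]
        in \<open>auto intro: less_imp_le\<close>)
  qed (use S \<delta> outputs_given_kernel[OF srv diff _ noise] d in auto)
  show ?thesis
    unfolding differentially_private_def
  proof (intro allI impI ballI)
    fix d d' :: "'x set" and S
    assume adj: "adjacent N d d'" and S: "S \<in> sets (output_space T :: (nat \<Rightarrow> real ^ 'm) measure)"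
    have fin: "finite d" "finite d'" using adj by (auto simp: adjacent_def)
    note moment = round_density_moment_le[OF C \<sigma> v m _ _ q]
    from adj consider x where "x \<notin> d" "d' = insert x d" | x where "x \<notin> d'" "d = insert x d'"
      by (auto simp: adjacent_def)
    then show "measure (dpsgd T d) S \<le> exp \<epsilon> * measure (dpsgd T d') S + \<delta>"
    proof cases
      case 1
      then show ?thesis
        using moment(2)[OF fin(1)] by (intro main[OF fin S, unfolded B_def]) (auto simp del: power_Suc of_nat_Suc)
    next
      case 2
      then show ?thesis
        using moment(1)[OF fin(2)] by (intro main[OF fin S, unfolded B_def]) (auto simp del: power_Suc of_nat_Suc)
    qed
  qed
qed

end

section \<open>Verification of the parameter conditions\<close>

theorem theoremB4:
  fixes N T :: nat and s :: "nat \<Rightarrow> nat"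
    and \<epsilon> \<delta> \<sigma> \<gamma> K sbar smax \<theta> C :: real
    and \<eta> :: "nat \<Rightarrow> real"
    and f :: "real ^ 'm::finite \<Rightarrow> 'x \<Rightarrow> real"
    and srv :: "('s, 'x, 'm) server"
  assumes "N \<ge> 1" and "T \<ge> 1"
    and "\<And>i. i < T \<Longrightarrow> 0 < s i \<and> s i \<le> N"
    and "\<epsilon> > 0" and "0 < \<delta>" and "\<delta> < 1" and "\<sigma> > 0"
    and "K = (\<Sum>i<T. real (s i))"
    and "sbar = K / real T"
    and "smax = real (Max (s ` {..<T}))"
    and "\<theta> = smax / sbar"
    and "gamma_admissible N K \<epsilon> \<sigma> \<gamma>"
    and "\<And>\<gamma>'. gamma_admissible N K \<epsilon> \<sigma> \<gamma>' \<Longrightarrow> \<gamma> \<le> \<gamma>'"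
    and "sbar \<le> g_fun (sqrt (2 * (\<epsilon> + ln (1 / \<delta>)) / \<epsilon>)) / \<theta> * real N"
    and "\<epsilon> \<le> \<gamma> * h_fun \<sigma> * (K / real N)"
    and "\<epsilon> \<ge> \<gamma> * \<theta>\<^sup>2 * (K / real N) * (sbar / real N)"
    and "\<sigma> \<ge> sqrt (2 * (\<epsilon> + ln (1 / \<delta>)) / \<epsilon>)"
    and "C > 0"
    and "\<And>w \<xi>. (\<lambda>v. f v \<xi>) differentiable at w"
    and "valid_server T srv"
  shows "differentially_private N \<epsilon> \<delta> (output_space T)
           (dpsgd_parameters.dpsgd N s (\<lambda>_. \<sigma>) C \<eta> f srv T)"
proof -
  define v where "v = 2 * (\<epsilon> + ln (1 / \<delta>)) / \<epsilon>"
  have ln\<delta>: "ln (1 / \<delta>) = - ln \<delta>" "ln \<delta> < 0"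
    using assms(5,6) by (simp_all add: ln_div)
  have \<epsilon>v: "\<epsilon> * v = 2 * \<epsilon> - 2 * ln \<delta>" and v: "v \<ge> 2"
    using assms(4) ln\<delta> by (simp_all add: v_def field_simps)
  have "(sqrt v)\<^sup>2 \<le> \<sigma>\<^sup>2"
    using assms(17)[folded v_def] v by (intro power_mono) auto
  then have \<sigma>v: "v \<le> \<sigma>\<^sup>2" using v by simp
  have N: "real N > 0" and T: "real T > 0" using assms(1,2) by auto
  have s_max: "real (s i) \<le> smax" if "i < T" for i
    using that unfolding assms(10) by (intro of_nat_mono Max_ge) auto
  have K: "K > 0"
    unfolding assms(8) using assms(2,3) by (intro sum_pos) (auto simp: lessThan_empty_iff)
  have sbar: "sbar > 0" using K T by (simp add: assms(9))
  have "K \<le> (\<Sum>i<T. smax)"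
    unfolding assms(8) by (intro sum_mono s_max) auto
  then have "sbar \<le> smax" using T by (simp add: assms(9) divide_le_eq mult.commute)
  then have \<theta>: "\<theta> \<ge> 1" "smax = \<theta> * sbar" using sbar by (simp_all add: assms(11))
  \<comment> \<open>Multiplied by \<theta>, the first requirement bounds the largest sample size.
    The branch 1 / (e x) of \<open>g_fun\<close> then gives the cap on every rate.\<close>
  have "smax \<le> g_fun (sqrt v) * real N"
    using mult_left_mono[OF assms(14)[folded v_def], of \<theta>] \<theta> by simp
  also have "\<dots> \<le> 1 / (exp 1 * sqrt v) * real N"
    by (intro mult_right_mono) (auto simp: g_fun_def)
  finally have smax: "smax / real N \<le> 1 / (exp 1 * sqrt v)" using N by (simp add: divide_le_eq)
  have qi: "real (s i) / real N \<le> 1 / (exp 1 * sqrt v)" if "i < T" for i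
    using divide_right_mono[OF s_max[OF that], of "real N"] smax by simp
  have \<gamma>: "\<gamma> \<ge> 2"
  proof -
    define \<alpha> where "\<alpha> = \<epsilon> * real N / (\<gamma> * K)"
    have \<gamma>0: "\<gamma> > 0" and \<alpha>1: "\<alpha> < 1" and \<alpha>2: "\<sigma> * (1 - \<alpha>) - 2 * exp 1 * sqrt \<alpha> > 0"
      and ge: "\<gamma> \<ge> 2 / (1 - \<alpha>) + 2 ^ 4 * \<alpha> / (1 - \<alpha>) *
             (\<sigma> / (1 - sqrt \<alpha>)\<^sup>2 + 1 / (\<sigma> * (1 - \<alpha>) - 2 * exp 1 * sqrt \<alpha>) * (exp 1 ^ 3 / \<sigma>)) *
             exp (3 / \<sigma>\<^sup>2)"
      using assms(12) by (auto simp: gamma_admissible_def Let_def \<alpha>_def)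
    have \<alpha>0: "\<alpha> \<ge> 0" using assms(4) N K \<gamma>0 by (simp add: \<alpha>_def)
    \<comment> \<open>The first summand of the lower bound on \<gamma> is already at least 2, and
      the remaining one is nonnegative.\<close>
    have "2 \<le> 2 / (1 - \<alpha>)" using \<alpha>0 \<alpha>1 by (simp add: le_divide_eq)
    moreover have "0 \<le> 2 ^ 4 * \<alpha> / (1 - \<alpha>) *
             (\<sigma> / (1 - sqrt \<alpha>)\<^sup>2 + 1 / (\<sigma> * (1 - \<alpha>) - 2 * exp 1 * sqrt \<alpha>) * (exp 1 ^ 3 / \<sigma>)) *
             exp (3 / \<sigma>\<^sup>2)"
      using \<alpha>0 \<alpha>1 \<alpha>2 assms(7)
      by (intro mult_nonneg_nonneg add_nonneg_nonneg divide_nonneg_nonneg) auto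
    ultimately show ?thesis using ge by linarith
  qed
  define Q where "Q = (\<Sum>i<T. (real (s i) / real N)\<^sup>2)"
  \<comment> \<open>One factor of each square is replaced by the maximum; the other factors sum to
    \<open>K\<close>.\<close>
  have "Q \<le> (\<Sum>i<T. smax * real (s i) / (real N)\<^sup>2)"
    unfolding Q_def power_divide using s_max
    by (intro sum_mono divide_right_mono) (auto simp: power2_eq_square intro: mult_right_mono)
  also have "\<dots> = \<theta> * (K / real N * (sbar / real N))"
    by (simp add: assms(8) \<theta>(2) sum_distrib_left sum_divide_distrib power2_eq_square mult_ac)
  also have "\<dots> \<le> \<theta>\<^sup>2 * (K / real N * (sbar / real N))"
    using \<theta> K N sbar by (intro mult_right_mono) (auto simp: power2_eq_square)
  finally have Q: "Q \<le> \<theta>\<^sup>2 * (K / real N * (sbar / real N))" .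
  have "2 * Q \<le> \<gamma> * Q"
    using \<gamma> by (intro mult_right_mono) (auto simp: Q_def intro: sum_nonneg)
  also have "\<dots> \<le> \<gamma> * (\<theta>\<^sup>2 * (K / real N * (sbar / real N)))"
    using Q \<gamma> by (intro mult_left_mono) auto
  also have "\<dots> \<le> \<epsilon>" using assms(16) by (simp add: mult_ac)
  finally have Q\<epsilon>: "Q \<le> \<epsilon> / 2" by simp
  define m where "m = nat \<lceil>v\<rceil> - 1"
  have Suc_m: "Suc m = nat \<lceil>v\<rceil>" using v by (simp add: m_def)
  have m: "v \<le> real (Suc m)" "real (Suc m) \<le> v + 1"
    unfolding Suc_m using v by linarith+
  have "Q * (2 * real (Suc m) - v) \<le> \<epsilon> / 2 * (2 * real (Suc m) - v)"
    using Q\<epsilon> m v by (intro mult_right_mono) auto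
  \<comment> \<open>By the choice of \<open>v\<close>, \<epsilon> v / 2 = \<epsilon> - ln \<delta>;
    so (\<epsilon> / 2) (2 a - v) = \<epsilon> (a - 1) + ln \<delta> with a = m + 1.\<close>
  also have "\<dots> = ln \<delta> + \<epsilon> * real m"
    using \<epsilon>v by (simp add: algebra_simps)
  finally have budget: "Q * (2 * real (Suc m) - v) \<le> ln \<delta> + \<epsilon> * real m" .
  show ?thesis
  proof (rule dpsgd_parameters.dpsgd_differentially_private[where \<sigma> = \<sigma> and v = v and m = m])
    show "(\<Sum>i<T. (real (s i) / real N)\<^sup>2) * (2 * real (Suc m) - v) \<le> ln \<delta> + \<epsilon> * real m"
      using budget by (simp only: Q_def)
    show "s i \<le> N" if "i < T" for i using assms(3)[OF that] by simp
  qed (fact assms \<sigma>v v m qi refl)+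
qed

end
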